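(* Let $a/q\in(0,1)$ and $a'/q'=T^2(a/q)\in[0,1)$ be reduced rationals, and set \[ W_p(a/q)=\frac1p\log\frac{\sum_{N=0}^{q-1}e^{p(S_N(a/q)-\mathrm{sgn}(p)N/(2q))}}{\sum_{N=0}^{q'-1}e^{p(S_N(a'/q')-\mathrm{sgn}(p)N/(2q'))}}+\frac{\lfloor q/a\rfloor(\mathrm{sgn}(p)2a-1)}{8qq'},\qquad p\neq\pm\infty,0, \] and \[ W_\infty(a/q)=\max_{0\le N<q}\left(S_N(a/q)-\frac{N}{2q}\right)-\max_{0\le N<q'}\left(S_N(a'/q')-\frac{N}{2q'}\right)+\frac{\lfloor q/a\rfloor(2a-1)}{8qq'}, \] \[ W_{-\infty}(a/q)=\min_{0\le N<q}\left(S_N(a/q)+\frac{N}{2q}\right)-\min_{0\le N<q'}\left(S_N(a'/q')+\frac{N}{2q'}\right)+\frac{\lfloor q/a\rfloor(-2a-1)}{8qq'}. \] (i) If $-\infty\le p<0$, then $\lim_{r\to(a/q)^+}h_p(r)=W_p(a/q)$. (ii) If $0<p\le\infty$ and $a\neq1$, then $\lim_{r\to(a/q)^-}h_p(r)=W_p(a/q)$.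
   Context: $\{x\}=x-\lfloor x\rfloor$ is the fractional part, $\mathrm{sgn}$ is the sign function, and $S_N(\alpha)=\sum_{n=1}^N(\{n\alpha\}-1/2)$, with $S_0(\alpha)=0$. For a rational $r$ whose denominator in reduced form is $q\ge1$ (the reduced form of $0$ being $0/1$), define \[ J_p(r)=\left(\sum_{N=0}^{q-1}e^{pS_N(r)}\right)^{1/p}\ (p\ne\pm\infty,0),\quad J_\infty(r)=\max_{0\le N<q}e^{S_N(r)},\quad J_{-\infty}(r)=\min_{0\le N<q}e^{S_N(r)}. \] The Gauss map $T:[0,1)\to[0,1)$ is $Tx=\{1/x\}$ for $x\ne0$ and $T0=0$; $T^2$ is its second iterate. For $r\in[0,1)\cap\mathbb{Q}$, $h_p(r)=\log\frac{J_p(r)}{J_p(T^2r)}$; the one-sided limits of $h_p$ are taken over rational $r$.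
   Formalization: In (i) with a = 1 the stated limit is false (e.g. a/q = 1/2, p = −∞: the limit is −3/16, while W = −3/8); for a = 1 and p < 0 the formal theorem gives the correct right-hand limit W_p(1/q) + 3/(8q) instead of W_p(1/q). *)

theory Defs
  imports "HOL-Analysis.Analysis"
begin

definition S :: "nat \<Rightarrow> real \<Rightarrow> real" where
  "S N \<alpha> = (\<Sum>n=1..N. (frac (real n * \<alpha>) - 1/2))"

text \<open>Denominator of a rational number in reduced form (unspecified on irrationals).\<close>

definition den :: "real \<Rightarrow> nat" where
  "den r = (THE q. q > 0 \<and> (\<exists>a::int. coprime a (int q) \<and> r = of_int a / real q))"

lemma den_eq:
  assumes "q > 0" "coprime a (int q)"
  shows "den (of_int a / real q) = q"
  unfolding den_def
proof (rule the_equality)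
  show "q > 0 \<and> (\<exists>b::int. coprime b (int q) \<and> of_int a / real q = of_int b / real q)"
    using assms by blast
next
  fix q' assume "q' > 0 \<and> (\<exists>b::int. coprime b (int q') \<and> of_int a / real q = of_int b / real q')"
  then obtain b :: int where b: "q' > 0" "coprime b (int q')"
    "of_int a / real q = of_int b / real q'" by blast
  have "of_int (a * int q') = (of_int (b * int q) :: real)"
    using b assms by (simp add: field_simps)
  then have eq: "a * int q' = b * int q" by (simp only: of_int_eq_iff)
  have "int q dvd a * int q'" "int q' dvd b * int q" using eq by (metis dvd_triv_right)+
  then have "int q dvd int q'" "int q' dvd int q"
    using assms(2) b(2) by (simp_all add: coprime_dvd_mult_right_iff coprime_commute)
  then show "q' = q" by (simp add: dvd_antisym)
qed

definition J :: "ereal \<Rightarrow> real \<Rightarrow> real" where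
  "J p r = (case p of
      ereal t \<Rightarrow> (\<Sum>N<den r. exp (t * S N r)) powr (1 / t)
    | PInfty \<Rightarrow> (MAX N\<in>{..<den r}. exp (S N r))
    | MInfty \<Rightarrow> (MIN N\<in>{..<den r}. exp (S N r)))"

definition gauss :: "real \<Rightarrow> real" where
  "gauss x = (if x = 0 then 0 else frac (1 / x))"

definition h :: "ereal \<Rightarrow> real \<Rightarrow> real" where
  "h p r = ln (J p r / J p ((gauss ^^ 2) r))"

text \<open>
  \<open>a/q\<close> and \<open>a'/q'\<close> are meant to be reduced, with \<open>a'/q'\<close> the image of \<open>a/q\<close> under the
  second iterate of the Gauss map.

  The limit of \<open>h p\<close> from the right at \<open>1/q\<close> (\<open>p < 0\<close>) is not \<open>W p 1 q 0 1\<close> but exceeds it by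
  \<open>3/(8q)\<close>: the coefficient \<open>\<lfloor>q/a\<rfloor>\<close> comes from \<open>\<lfloor>1/r\<rfloor>\<close>, which equals \<open>q - 1\<close> for \<open>r\<close>
  slightly larger than \<open>1/q\<close>.  For \<open>a \<noteq> 1\<close> it is constant near \<open>a/q\<close>.
\<close>

definition W :: "ereal \<Rightarrow> nat \<Rightarrow> nat \<Rightarrow> nat \<Rightarrow> nat \<Rightarrow> real" where
  "W p a q a' q' = (case p of
      ereal t \<Rightarrow>
        1 / t * ln ((\<Sum>N<q. exp (t * (S N (real a / real q) - sgn t * real N / (2 * real q)))) /
                    (\<Sum>N<q'. exp (t * (S N (real a' / real q') - sgn t * real N / (2 * real q')))))
        + of_int \<lfloor>real q / real a\<rfloor> * (sgn t * 2 * real a - 1) / (8 * real q * real q')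
    | PInfty \<Rightarrow>
        (MAX N\<in>{..<q}. S N (real a / real q) - real N / (2 * real q))
        - (MAX N\<in>{..<q'}. S N (real a' / real q') - real N / (2 * real q'))
        + of_int \<lfloor>real q / real a\<rfloor> * (2 * real a - 1) / (8 * real q * real q')
    | MInfty \<Rightarrow>
        (MIN N\<in>{..<q}. S N (real a / real q) + real N / (2 * real q))
        - (MIN N\<in>{..<q'}. S N (real a' / real q') + real N / (2 * real q'))
        + of_int \<lfloor>real q / real a\<rfloor> * (- 2 * real a - 1) / (8 * real q * real q'))"

end

(*
  Counting lattice points below the line of slope z expresses S_N(z) as S_M({-1/z}) plus an explicit
  quadratic function of {Nz}, where M = floor(Nz). Hence a sum of exp(p S_N(z)) weighted by a function
  of {Nz} is a sum of exp(p S_M({-1/z})) weighted by a function of {M{-1/z}}. For p < 0 and z near 0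
  from the right the inner sums concentrate at {Nz} = 1/2, uniformly in M. Transporting this along
  z -> {-1/z}, which preserves approach from the right, shows that as z decreases to c/d the
  probability weights exp(p S_N(z)) at {Nz} converge to weights exp(p (S_N(c/d) + N/(2d))) at
  {Nc/d} + 1/(2d). The same transfer with {1/z} in place of {-1/z} reverses the side and the sign of
  S, and one step of each kind compares J_p(r) with J_p(T^2 r). Positive p reduce to negative p by
  S_N(-x) = -S_N(x).
*)
theory Submission
  imports Defs
begin

text \<open>As \<open>r\<close> approaches a rational, its denominator tends to infinity, so no
  fixed finite family of terms is available for a termwise limit. The soft minima of
  \<open>S N r\<close> themselves diverge: near 0 the parabola \<open>phi z\<close> already has
  minimum about -1/(8 z). Only differences of soft minima, that is logarithms of ratios of sums,
  converge. A weight in {N z} has to be carried along because one transfer turns even the weight 0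
  into a nontrivial one.

  The half shifts descend from the single concentration point 1/2 at the rational 0/1, where 1/2 =
  1/(2 d) with d = 1; each transfer carries the shift 1/(2 c) at denominator c to \<sigma>/(2 d) at
  denominator d. Shifted points are half-odd multiples of 1/d, hence never at a discontinuity of the
  fractional part.

  At a = 1 the two sides differ. From the right, {1/r} tends to 1 instead of T(1/q) = 0, which only
  changes a constant. From the left, {1/r} tends to 0 and 1/{1/r} is unbounded, so the second step
  breaks down.\<close>

section \<open>Soft minima\<close>

text \<open>
  Treats finite \<open>p < 0\<close> and \<open>p = -\<infinity>\<close> at once: \<open>ln (J p r)\<close> is the soft minimum of \<open>S N r\<close>.
  Positive \<open>p\<close> is reached through \<open>- p\<close> and the values \<open>- S N r\<close>.
\<close>

definition softmin :: "ereal \<Rightarrow> 'a set \<Rightarrow> ('a \<Rightarrow> real) \<Rightarrow> real" where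
  "softmin p I g = (case p of
      ereal t \<Rightarrow> ln (\<Sum>i\<in>I. exp (t * g i)) / t
    | _ \<Rightarrow> Min (g ` I))"

lemma softmin_simps [simp]:
  "softmin (ereal t) I g = ln (\<Sum>i\<in>I. exp (t * g i)) / t"
  "softmin (-\<infinity>) I g = Min (g ` I)"
  by (simp_all add: softmin_def flip: MInfty_eq_minfinity)

lemma negative_ereal_cases:
  assumes "p < (0::ereal)"
  obtains t where "p = ereal t" "t < 0" | "p = -\<infinity>"
  using assms by (cases p) auto

lemma softmin_cong:
  "I = I' \<Longrightarrow> (\<And>i. i \<in> I' \<Longrightarrow> g i = g' i) \<Longrightarrow> softmin p I g = softmin p I' g'"
  by (auto simp: softmin_def cong: sum.cong image_cong_simp split: ereal.split)

lemma sum_exp_pos: "finite I \<Longrightarrow> I \<noteq> {} \<Longrightarrow> (\<Sum>i\<in>I. exp (g i :: real)) > 0"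
  by (intro sum_pos) auto

lemma softmin_reindex:
  assumes "bij_betw f I K"
  shows "softmin p I (\<lambda>i. g (f i)) = softmin p K g"
proof -
  have "(\<Sum>i\<in>I. exp (t * g (f i))) = (\<Sum>k\<in>K. exp (t * g k))" for t
    using sum.reindex_bij_betw[OF assms] .
  moreover have "(\<lambda>i. g (f i)) ` I = g ` K"
    using assms by (auto simp: bij_betw_def)
  ultimately show ?thesis by (simp add: softmin_def split: ereal.split)
qed

lemma softmin_add_const:
  assumes "p < 0" "finite I" "I \<noteq> {}"
  shows "softmin p I (\<lambda>i. g i + c) = softmin p I g + c"
  using assms(1)
proof (cases rule: negative_ereal_cases)
  case (1 t)
  have "(\<Sum>i\<in>I. exp (t * (g i + c))) = (\<Sum>i\<in>I. exp (t * g i)) * exp (t * c)"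
    by (simp add: sum_distrib_right ring_distribs exp_add)
  then show ?thesis
    using 1 sum_exp_pos[OF assms(2,3), of "\<lambda>i. t * g i"] by (simp add: ln_mult add_divide_distrib)
next
  case 2
  then show ?thesis using Min_add_commute[OF assms(2,3), of g c] by simp
qed

lemma softmin_mono:
  assumes "p < 0" "finite I" "I \<noteq> {}" "\<And>i. i \<in> I \<Longrightarrow> g i \<le> g' i"
  shows "softmin p I g \<le> softmin p I g'"
  using assms(1)
proof (cases rule: negative_ereal_cases)
  case (1 t)
  have "(\<Sum>i\<in>I. exp (t * g' i)) \<le> (\<Sum>i\<in>I. exp (t * g i))"
    using assms(4) 1 by (intro sum_mono) auto
  then show ?thesis
    using 1 sum_exp_pos[OF assms(2,3), of "\<lambda>i. t * g' i"] by (simp add: divide_right_mono_neg)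
next
  case 2
  have "Min (g ` I) \<le> g' i" if "i \<in> I" for i
    using assms(2) assms(4)[OF that] that by (meson Min_le finite_imageI imageI order_trans)
  then show ?thesis using 2 assms(2,3) by simp
qed

text \<open>Monotone and compatible with constants, hence 1-Lipschitz for the sup norm. The
  Lipschitz constant does not depend on the size of \<open>I\<close>, which later tends to
  infinity.\<close>

lemma softmin_near:
  assumes "p < 0" "finite I" "I \<noteq> {}" "\<And>i. i \<in> I \<Longrightarrow> \<bar>g i - g' i\<bar> \<le> e"
  shows "\<bar>softmin p I g - softmin p I g'\<bar> \<le> e"
proof -
  have "softmin p I g \<le> softmin p I (\<lambda>i. g' i + e)" "softmin p I g' \<le> softmin p I (\<lambda>i. g i + e)"
    using assms(4) by (fastforce intro!: softmin_mono[OF assms(1-3)])+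
  then show ?thesis by (simp add: softmin_add_const[OF assms(1-3)])
qed

text \<open>Soft minima nest: for finite \<open>p\<close> the exponential undoes the inner logarithm
  and leaves a sum grouped by fibres.\<close>

lemma softmin_fibres:
  assumes "p < 0" "finite I" "I \<noteq> {}" "f ` I = K"
  shows "softmin p I g = softmin p K (\<lambda>k. softmin p {i\<in>I. f i = k} g)"
  using assms(1)
proof (cases rule: negative_ereal_cases)
  case (1 t)
  have "exp (ln (\<Sum>i | i \<in> I \<and> f i = k. exp (t * g i))) = (\<Sum>i | i \<in> I \<and> f i = k. exp (t * g i))"
    if "k \<in> K" for k
  proof -
    have "(\<Sum>i | i \<in> I \<and> f i = k. exp (t * g i)) > 0"
      using assms(2,4) that by (intro sum_exp_pos) auto
    then show ?thesis by simp
  qed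
  then show ?thesis
    using 1 sum.image_gen[OF assms(2), of "\<lambda>i. exp (t * g i)" f] assms(4) by simp
next
  case 2
  have fin: "finite {i\<in>I. f i = k}" for k using assms(2) by simp
  have "Min (g ` I) = (MIN k\<in>K. Min (g ` {i\<in>I. f i = k}))"
  proof (rule antisym)
    show "Min (g ` I) \<le> (MIN k\<in>K. Min (g ` {i\<in>I. f i = k}))"
      using assms(2-4) by (intro Min.boundedI) (auto intro!: Min_antimono)
    have "(MIN k\<in>K. Min (g ` {i\<in>I. f i = k})) \<le> g i" if "i \<in> I" for i
    proof -
      have "(MIN k\<in>K. Min (g ` {i\<in>I. f i = k})) \<le> Min (g ` {j\<in>I. f j = f i})"
        using assms(2,4) that by (intro Min_le) auto
      also have "\<dots> \<le> g i" using assms(2) that by (intro Min_le) auto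
      finally show ?thesis .
    qed
    then show "(MIN k\<in>K. Min (g ` {i\<in>I. f i = k})) \<le> Min (g ` I)"
      using assms(2,3) by simp
  qed
  then show ?thesis using 2 by simp
qed

lemma softmin_tendsto:
  assumes "p < 0" "finite I" "I \<noteq> {}" "\<And>j. j \<in> I \<Longrightarrow> ((\<lambda>i. g i j) \<longlongrightarrow> g0 j) F"
  shows "((\<lambda>i. softmin p I (g i)) \<longlongrightarrow> softmin p I g0) F"
proof (rule tendstoI)
  fix e :: real assume "e > 0"
  have "\<forall>\<^sub>F i in F. \<forall>j\<in>I. dist (g i j) (g0 j) < e / 2"
    using assms(4) \<open>e > 0\<close> by (intro eventually_ball_finite[OF assms(2)]) (auto intro!: tendstoD simp del: less_divide_eq_numeral1)
  then show "\<forall>\<^sub>F i in F. dist (softmin p I (g i)) (softmin p I g0) < e"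
  proof eventually_elim
    case (elim i)
    then have "\<bar>softmin p I (g i) - softmin p I g0\<bar> \<le> e / 2"
      by (intro softmin_near[OF assms(1-3)]) (auto simp: dist_real_def less_imp_le)
    then show ?case using \<open>e > 0\<close> by (simp add: dist_real_def)
  qed
qed

text \<open>Price per index in a crude bound: for finite \<open>p\<close> the soft minimum of n
  zeros is ln n / t, and ln n is at most n.\<close>

definition softmin_slack :: "ereal \<Rightarrow> real" where
  "softmin_slack p = (case p of ereal t \<Rightarrow> - 1 / t | _ \<Rightarrow> 0)"

lemma softmin_slack_simps [simp]:
  "softmin_slack (ereal t) = - 1 / t" "softmin_slack (-\<infinity>) = 0"
  by (simp_all add: softmin_slack_def flip: MInfty_eq_minfinity)

lemma softmin_slack_nonneg: "p < 0 \<Longrightarrow> softmin_slack p \<ge> 0"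
  by (erule negative_ereal_cases) (auto simp: divide_nonneg_neg divide_nonpos_neg)

lemma softmin_bound:
  assumes "p < 0" "finite I" "I \<noteq> {}" "\<And>i. i \<in> I \<Longrightarrow> \<bar>g i\<bar> \<le> B"
  shows "\<bar>softmin p I g\<bar> \<le> B + card I * softmin_slack p"
proof -
  have "\<bar>softmin p I (\<lambda>_. 0)\<bar> \<le> card I * softmin_slack p"
    using assms(1)
  proof (cases rule: negative_ereal_cases)
    case (1 t)
    have "card I \<ge> 1" using assms(2,3) by (simp add: Suc_le_eq card_gt_0_iff)
    then have "0 \<le> ln (real (card I))" "ln (real (card I)) \<le> card I"
      using ln_le_minus_one[of "real (card I)"] by auto
    then show ?thesis using 1 by (simp add: divide_simps)
  next
    case 2
    then show ?thesis using assms(3) by (simp add: image_constant_conv)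
  qed
  moreover have "\<bar>softmin p I g - softmin p I (\<lambda>_. 0)\<bar> \<le> B"
    using assms(4) by (intro softmin_near[OF assms(1-3)]) auto
  ultimately show ?thesis by linarith
qed

text \<open>
  The cost of discarding \<open>n\<close> values that exceed a kept one by at least \<open>D\<close>; for \<open>p = -\<infinity>\<close> there
  is none.
\<close>

definition softmin_error :: "ereal \<Rightarrow> real \<Rightarrow> real \<Rightarrow> real" where
  "softmin_error p n D = (case p of ereal t \<Rightarrow> n * exp (t * D) / (- t) | _ \<Rightarrow> 0)"

lemma softmin_error_simps [simp]:
  "softmin_error (ereal t) n D = n * exp (t * D) / (- t)" "softmin_error (-\<infinity>) n D = 0"
  by (simp_all add: softmin_error_def flip: MInfty_eq_minfinity)

text \<open>Each dropped term is at most exp(t D) times the kept term at \<open>i0\<close>, hence at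
  most exp(t D) times the whole kept sum; then ln(1 + x) is at most x.\<close>

lemma softmin_drop:
  assumes "p < 0" "finite I" "K \<subseteq> I" "i0 \<in> I - K" "D \<ge> 0" "\<And>j. j \<in> K \<Longrightarrow> g j \<ge> g i0 + D"
    and "real (card K) \<le> n"
  shows "\<bar>softmin p I g - softmin p (I - K) g\<bar> \<le> softmin_error p n D"
  using assms(1)
proof (cases rule: negative_ereal_cases)
  case (1 t)
  let ?A = "\<Sum>i\<in>I - K. exp (t * g i)" and ?F = "\<Sum>i\<in>K. exp (t * g i)"
  have n: "n \<ge> 0" using assms(7) by linarith
  have A: "?A > 0" using assms(2,4) by (intro sum_exp_pos) auto
  have I: "(\<Sum>i\<in>I. exp (t * g i)) = ?A + ?F"
    using sum.subset_diff[OF assms(3,2)] by simp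
  have "?F \<le> (\<Sum>i\<in>K. exp (t * D) * exp (t * g i0))"
    using assms(6) 1 by (intro sum_mono) (simp add: add.commute flip: exp_add distrib_left)
  also have "\<dots> \<le> n * exp (t * D) * exp (t * g i0)"
    using assms(7) by (simp add: mult_right_mono)
  also have "exp (t * g i0) \<le> ?A"
    using assms(2,4) by (intro member_le_sum) auto
  finally have "?F \<le> n * exp (t * D) * ?A"
    using assms(7) by (simp add: mult_left_mono)
  then have "?A + ?F \<le> ?A * (1 + n * exp (t * D))"
    by (simp add: algebra_simps)
  moreover have F0: "?F \<ge> 0" by (intro sum_nonneg) auto
  ultimately have "ln (?A + ?F) \<le> ln (?A * (1 + n * exp (t * D)))"
    using A n by (simp add: add_pos_nonneg)
  also have "\<dots> \<le> ln ?A + n * exp (t * D)"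
  proof -
    have "ln (1 + n * exp (t * D)) \<le> n * exp (t * D)"
      using n by (intro ln_add_one_self_le_self) simp
    moreover have "1 + n * exp (t * D) > 0" using n by (simp add: add_pos_nonneg)
    ultimately show ?thesis using A by (simp add: ln_mult_pos)
  qed
  finally have "ln (?A + ?F) - ln ?A \<le> n * exp (t * D)" by simp
  moreover have "ln ?A \<le> ln (?A + ?F)" using A F0 by simp
  ultimately have "\<bar>ln (?A + ?F) / t - ln ?A / t\<bar> \<le> n * exp (t * D) / (- t)"
    using 1 by (simp add: divide_simps abs_if flip: diff_divide_distrib)
  then show ?thesis using 1 I by simp
next
  case 2
  have "Min (g ` I) = Min (g ` (I - K))"
  proof (rule antisym)
    show "Min (g ` I) \<le> Min (g ` (I - K))"
      using assms(2,4) by (intro Min_antimono) auto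
    have le: "Min (g ` (I - K)) \<le> g j" if "j \<in> I - K" for j
      using assms(2) that by (intro Min_le) auto
    have "Min (g ` (I - K)) \<le> g j" if "j \<in> I" for j
      using le[of j] le[OF assms(4)] assms(5) assms(6)[of j] that by fastforce
    then show "Min (g ` (I - K)) \<le> Min (g ` I)"
      using assms(2,4) by (subst Min_ge_iff) auto
  qed
  then show ?thesis using 2 by simp
qed

section \<open>Reciprocity for Birkhoff sums\<close>

definition phi :: "real \<Rightarrow> real \<Rightarrow> real" where
  "phi z \<theta> = \<theta> / 2 - \<theta> * (1 - \<theta>) / (2 * z)"

lemma S_0 [simp]: "S 0 x = 0"
  by (simp add: S_def)

lemma S_Suc: "S (Suc N) x = S N x + (frac (real (Suc N) * x) - 1/2)"
  by (simp add: S_def)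

lemma frac_diff_of_int: "frac (x - of_int k) = frac (x::real)"
  by (simp add: frac_def)

lemma frac_mult_frac: "frac (real n * frac x) = frac (real n * x)"
proof -
  have "real n * frac x = real n * x - of_int (int n * \<lfloor>x\<rfloor>)"
    by (simp add: frac_def algebra_simps)
  then show ?thesis by (simp only: frac_diff_of_int)
qed

lemma S_frac [simp]: "S N (frac x) = S N x"
  by (simp add: S_def frac_mult_frac)

lemma S_minus:
  assumes "\<And>n. 0 < n \<Longrightarrow> n \<le> N \<Longrightarrow> real n * x \<notin> \<int>"
  shows "S N (- x) = - S N x"
proof -
  have "frac (real n * - x) - 1/2 = - (frac (real n * x) - 1/2)" if "n \<in> {1..N}" for n
    using assms[of n] that by (simp add: frac_neg)
  then show ?thesis by (simp add: S_def sum_negf[symmetric])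
qed

text \<open>With M = floor(N z), the lattice points of the N by M rectangle below and above the line
  give sum of floor(n z) + sum of floor(m/z) = N M. What is left of the two Birkhoff sums is
  quadratic in N z - M, namely \<open>phi z\<close>. The induction uses that for z at most 1 the
  floor grows by at most one per step, so at most one term of the dual sum is added.\<close>

lemma S_reciprocity:
  assumes "0 < z" "z \<le> 1" "\<And>n. 0 < n \<Longrightarrow> n \<le> N \<Longrightarrow> real n * z \<notin> \<int>"
  shows "S N z = phi z (frac (real N * z)) - S (nat \<lfloor>real N * z\<rfloor>) (1 / z)"
  using assms(3)
proof (induction N)
  case 0
  then show ?case by (simp add: phi_def)
next
  case (Suc N)
  define M where "M = nat \<lfloor>real N * z\<rfloor>"
  define \<theta> where "\<theta> = frac (real N * z)"
  have M: "\<lfloor>real N * z\<rfloor> = int M" using assms(1) by (simp add: M_def)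
  have Nz: "real N * z = real M + \<theta>"
    using M by (simp add: \<theta>_def frac_def)
  have \<theta>: "0 \<le> \<theta>" "\<theta> < 1" by (simp_all add: \<theta>_def frac_lt_1)
  have IH: "S N z = phi z \<theta> - S M (1 / z)"
    using Suc by (simp add: M_def \<theta>_def)
  have step: "real (Suc N) * z = real M + (\<theta> + z)" using Nz by (simp add: algebra_simps)
  have "frac (real (Suc N) * z) \<noteq> 0"
    using Suc.prems[of "Suc N"] by (simp add: frac_eq_0_iff del: of_nat_Suc)
  show ?case
  proof (cases "\<theta> + z < 1")
    case True
    then have "\<lfloor>real (Suc N) * z\<rfloor> = int M"
      unfolding step using \<theta> assms by (intro floor_unique) auto
    moreover from this have "frac (real (Suc N) * z) = \<theta> + z"
      using step by (simp add: frac_def)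
    ultimately show ?thesis
      using assms(1) by (simp only: S_Suc IH phi_def nat_int) (simp add: field_simps)
  next
    case False
    then have fl: "\<lfloor>real (Suc N) * z\<rfloor> = int (Suc M)"
      unfolding step using \<theta> assms by (intro floor_unique) auto
    then have fr: "frac (real (Suc N) * z) = \<theta> + z - 1"
      using step by (simp add: frac_def)
    \<comment> \<open>Strictness matters: at 0 the number (M + 1)/z would be the integer N + 1, with
      fractional part 0 where the formula needs 1.\<close>
    have pos: "\<theta> + z - 1 > 0" using \<open>frac (real (Suc N) * z) \<noteq> 0\<close> False fr by linarith
    have "real (Suc M) * (1 / z) = real N + (1 - (\<theta> + z - 1) / z)"
      using Nz assms(1) by (simp add: field_simps)
    moreover have "0 \<le> 1 - (\<theta> + z - 1) / z" "1 - (\<theta> + z - 1) / z < 1"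
      using pos assms \<theta> by (simp_all add: field_simps)
    ultimately have "frac (real (Suc M) * (1 / z)) = 1 - (\<theta> + z - 1) / z"
      by (simp add: frac_unique_iff)
    then show ?thesis
      using assms(1) fl fr by (simp only: S_Suc IH phi_def nat_int) (simp add: field_simps)
  qed
qed

section \<open>Reduced fractions and their multiples\<close>

lemma frac_of_int_divide:
  assumes "A > 0"
  shows "frac (of_int k / real A) = of_int (k mod int A) / real A"
proof -
  have "\<lfloor>of_int k / real A\<rfloor> = k div int A"
    using floor_divide_of_int_eq[of k "int A", where ?'a = real] by simp
  moreover have "real_of_int k = of_int (k div int A) * real A + of_int (k mod int A)"
    by (metis div_mult_mod_eq of_int_add of_int_mult of_int_of_nat_eq)
  ultimately show ?thesis using assms by (simp add: frac_def field_simps)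
qed

lemma den_frac:
  assumes "A > 0" "coprime k (int A)"
  shows "den (frac (of_int k / real A)) = A"
  using assms by (simp add: frac_of_int_divide den_eq)

lemma den_of_nat_divide:
  assumes "A > 0" "coprime k A"
  shows "den (real k / real A) = A"
  using den_eq[of A "int k"] assms by simp

lemma mult_divide_not_Ints:
  assumes "coprime A Q" "0 < n" "n < Q"
  shows "real n * (real A / real Q) \<notin> \<int>"
proof
  assume "real n * (real A / real Q) \<in> \<int>"
  then obtain k :: int where "real n * (real A / real Q) = of_int k" by (elim Ints_cases)
  then have "real_of_int (int n * int A) = of_int (k * int Q)"
    using assms by (simp add: field_simps)
  then have "int n * int A = k * int Q" by (simp only: of_int_eq_iff)
  then have "Q dvd n * A" by (metis dvd_triv_right int_dvd_int_iff of_nat_mult)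
  then have "Q dvd n" using assms(1) by (simp add: coprime_dvd_mult_left_iff coprime_commute)
  then show False using assms by (simp add: nat_dvd_not_less)
qed

lemma rational_unit_cases:
  assumes "z \<in> \<rat>" "0 < z" "z < (1::real)"
  obtains A Q :: nat where "0 < A" "A < Q" "coprime A Q" "z = real A / real Q"
proof -
  obtain m n :: nat where mn: "n \<noteq> 0" "\<bar>z\<bar> = real m / real n" "coprime m n"
    using Rats_abs_nat_div_natE[OF assms(1)] by blast
  have "z = real m / real n" using mn(2) assms by simp
  moreover have "0 < real m" "real m < real n"
    using assms mn(1) unfolding \<open>z = real m / real n\<close> by (simp_all add: zero_less_divide_iff)
  then have "0 < m" "m < n" by simp_all
  ultimately show ?thesis using that mn by blast
qed

text \<open>
  The numbers \<open>z * (v + j)\<close> are the values of \<open>frac (N z + s)\<close> on the fibre \<open>\<lfloor>N z + s\<rfloor> = M\<close>, where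
  \<open>v = frac ((s - M) / z)\<close>.
\<close>

definition fibre_min :: "ereal \<Rightarrow> real \<Rightarrow> (real \<Rightarrow> real) \<Rightarrow> real \<Rightarrow> real" where
  "fibre_min p z g v = softmin p {j::nat. z * (v + real j) < 1} (\<lambda>j. g (z * (v + real j)))"

lemma fibre_min_index:
  assumes "0 < z" "z \<le> 1" "0 \<le> v" "v < 1"
  shows "finite {j::nat. z * (v + real j) < 1}" "{j::nat. z * (v + real j) < 1} \<noteq> {}"
    "real (card {j::nat. z * (v + real j) < 1}) \<le> 1 / z + 1"
proof -
  have sub: "{j::nat. z * (v + real j) < 1} \<subseteq> {..nat \<lfloor>1 / z\<rfloor>}"
  proof
    fix j :: nat assume "j \<in> {j::nat. z * (v + real j) < 1}"
    then have "z * v + z * real j < 1" by (simp add: distrib_left)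
    moreover have "z * v \<ge> 0" using assms by simp
    ultimately have "z * real j < 1" by linarith
    then have "real j \<le> 1 / z" using assms by (simp add: field_simps)
    then show "j \<in> {..nat \<lfloor>1 / z\<rfloor>}" by (simp add: le_nat_floor)
  qed
  then show "finite {j::nat. z * (v + real j) < 1}" by (rule finite_subset) simp
  have "card {j::nat. z * (v + real j) < 1} \<le> nat \<lfloor>1 / z\<rfloor> + 1"
    using card_mono[OF _ sub] by simp
  moreover have "real (nat \<lfloor>1 / z\<rfloor>) \<le> 1 / z" using assms by simp
  ultimately show "real (card {j::nat. z * (v + real j) < 1}) \<le> 1 / z + 1" by linarith
  have "z * v \<le> v" using assms by (simp add: mult_left_le_one_le)
  then have "0 \<in> {j::nat. z * (v + real j) < 1}" using assms by simp
  then show "{j::nat. z * (v + real j) < 1} \<noteq> {}" by blast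
qed

text \<open>Writing (s - M)/z = k + v with integer k gives N z + s - M = z (v + N + k), so j = N + k
  runs through the fibre. The bound s < z forces k to be nonpositive, so every natural j comes from
  a natural N.\<close>

lemma softmin_floor_fibre:
  assumes "0 < z" "s < z"
  shows "softmin p {N::nat. \<lfloor>real N * z + s\<rfloor> = int M} (\<lambda>N. g (frac (real N * z + s)))
    = fibre_min p z g (frac ((s - real M) / z))"
proof -
  define k where "k = \<lfloor>(s - real M) / z\<rfloor>"
  define v where "v = frac ((s - real M) / z)"
  have "(s - real M) / z < 1" using assms by (simp add: field_simps)
  then have k: "k \<le> 0" by (simp add: k_def floor_le_iff)
  have v: "0 \<le> v" "v < 1" by (simp_all add: v_def frac_lt_1)
  have kv: "s - real M = z * (of_int k + v)"
    using assms by (simp add: k_def v_def frac_def)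
  define f where "f j = j + nat (- k)" for j
  have f: "real (f j) * z + s = real M + z * (v + real j)" for j
    using kv k by (simp add: f_def algebra_simps)
  have fl: "\<lfloor>real (f j) * z + s\<rfloor> = int M \<longleftrightarrow> z * (v + real j) < 1" for j
    unfolding f using v assms by (simp add: floor_eq_iff)
  have fr: "frac (real (f j) * z + s) = z * (v + real j)" if "z * (v + real j) < 1" for j
    using f[of j] fl[of j] that by (simp add: frac_def)
  have "bij_betw f {j::nat. z * (v + real j) < 1} {N::nat. \<lfloor>real N * z + s\<rfloor> = int M}"
    unfolding bij_betw_def
  proof
    show "inj_on f {j. z * (v + real j) < 1}" by (auto simp: inj_on_def f_def)
    show "f ` {j. z * (v + real j) < 1} = {N. \<lfloor>real N * z + s\<rfloor> = int M}"
    proof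
      show "f ` {j. z * (v + real j) < 1} \<subseteq> {N. \<lfloor>real N * z + s\<rfloor> = int M}" using fl by auto
      show "{N. \<lfloor>real N * z + s\<rfloor> = int M} \<subseteq> f ` {j. z * (v + real j) < 1}"
      proof
        fix N assume "N \<in> {N. \<lfloor>real N * z + s\<rfloor> = int M}"
        then have N: "\<lfloor>real N * z + s\<rfloor> = int M" by simp
        then have "0 \<le> real N * z + (s - real M)" by linarith
        then have "0 \<le> z * (real N + of_int k + v)" unfolding kv by (simp add: algebra_simps)
        then have "0 \<le> real N + of_int k + v" using assms by (simp add: zero_le_mult_iff)
        then have "int N + k \<ge> 0" using v by linarith
        then have "N = f (nat (int N + k))" using k by (simp add: f_def)
        then show "N \<in> f ` {j. z * (v + real j) < 1}" using fl N by (metis (mono_tags) imageI mem_Collect_eq)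
      qed
    qed
  qed
  then have "softmin p {N::nat. \<lfloor>real N * z + s\<rfloor> = int M} (\<lambda>N. g (frac (real N * z + s)))
      = softmin p {j::nat. z * (v + real j) < 1} (\<lambda>j. g (frac (real (f j) * z + s)))"
    by (rule softmin_reindex[symmetric])
  also have "\<dots> = fibre_min p z g v"
    unfolding fibre_min_def by (rule softmin_cong) (simp_all add: fr)
  finally show ?thesis by (simp add: v_def)
qed

text \<open>Grouping by the floor. The shift \<open>s\<close> is 0 for the actual sums and
  \<sigma>/(2 d) for the limiting ones, so that one decomposition serves both.\<close>

lemma softmin_floor_decomposition:
  assumes "p < 0" "0 < z" "z \<le> 1" "s < z" "0 < c"
  shows "softmin p {N::nat. 0 \<le> real N * z + s \<and> real N * z + s < real c}
      (\<lambda>N. a (nat \<lfloor>real N * z + s\<rfloor>) + g (frac (real N * z + s)))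
    = softmin p {..<c} (\<lambda>M. a M + fibre_min p z g (frac ((s - real M) / z)))"
proof -
  define I where "I = {N::nat. 0 \<le> real N * z + s \<and> real N * z + s < real c}"
  define \<kappa> where "\<kappa> N = nat \<lfloor>real N * z + s\<rfloor>" for N
  have fibre: "{N\<in>I. \<kappa> N = M} = {N::nat. \<lfloor>real N * z + s\<rfloor> = int M}" if "M < c" for M
    using that by (auto simp: I_def \<kappa>_def) linarith+
  have ne: "\<exists>N::nat. \<lfloor>real N * z + s\<rfloor> = int M" for M
  proof -
    \<comment> \<open>The first index at which N z + s reaches M; a step of length at most 1 cannot
      jump over the interval from M to M + 1.\<close>
    define N where "N = nat \<lceil>(real M - s) / z\<rceil>"
    have "(real M - s) / z > -1" using assms by (simp add: field_simps)
    then have "\<lceil>(real M - s) / z\<rceil> \<ge> 0" by linarith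
    then have N: "real N \<ge> (real M - s) / z" "real N < (real M - s) / z + 1"
      unfolding N_def by linarith+
    have "real N * z \<ge> real M - s" "real N * z < real M - s + z"
      using N assms by (simp_all add: field_simps)
    then have "\<lfloor>real N * z + s\<rfloor> = int M" using assms by (intro floor_unique) auto
    then show ?thesis ..
  qed
  have "I \<subseteq> {..nat \<lfloor>(real c - s) / z\<rfloor>}"
  proof
    fix N assume "N \<in> I"
    then have "real N \<le> (real c - s) / z" using assms by (simp add: I_def field_simps)
    then show "N \<in> {..nat \<lfloor>(real c - s) / z\<rfloor>}" by (simp add: le_nat_floor)
  qed
  then have fin: "finite I" by (rule finite_subset) simp
  have im: "\<kappa> ` I = {..<c}"
  proof
    show "\<kappa> ` I \<subseteq> {..<c}" by (auto simp: I_def \<kappa>_def) linarith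
    show "{..<c} \<subseteq> \<kappa> ` I"
    proof
      fix M assume M: "M \<in> {..<c}"
      obtain N :: nat where "\<lfloor>real N * z + s\<rfloor> = int M" using ne by blast
      then have "N \<in> {N\<in>I. \<kappa> N = M}" using fibre M by simp
      then show "M \<in> \<kappa> ` I" by blast
    qed
  qed
  then have "I \<noteq> {}" using assms(5) by auto
  have "softmin p I (\<lambda>N. a (\<kappa> N) + g (frac (real N * z + s)))
     = softmin p {..<c} (\<lambda>M. softmin p {N\<in>I. \<kappa> N = M} (\<lambda>N. a (\<kappa> N) + g (frac (real N * z + s))))"
    by (rule softmin_fibres[OF assms(1) fin \<open>I \<noteq> {}\<close> im])
  also have "\<dots> = softmin p {..<c} (\<lambda>M. a M + fibre_min p z g (frac ((s - real M) / z)))"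
  proof (rule softmin_cong[OF refl])
    fix M assume M: "M \<in> {..<c}"
    then have f: "{N\<in>I. \<kappa> N = M} = {N::nat. \<lfloor>real N * z + s\<rfloor> = int M}" using fibre by simp
    have "finite {N\<in>I. \<kappa> N = M}" using fin by simp
    moreover have "{N\<in>I. \<kappa> N = M} \<noteq> {}" using ne unfolding f by auto
    ultimately have "softmin p {N\<in>I. \<kappa> N = M} (\<lambda>N. g (frac (real N * z + s)) + a M)
        = softmin p {N\<in>I. \<kappa> N = M} (\<lambda>N. g (frac (real N * z + s))) + a M"
      by (rule softmin_add_const[OF assms(1)])
    moreover have "softmin p {N\<in>I. \<kappa> N = M} (\<lambda>N. a (\<kappa> N) + g (frac (real N * z + s)))
        = softmin p {N\<in>I. \<kappa> N = M} (\<lambda>N. g (frac (real N * z + s)) + a M)"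
      by (rule softmin_cong) auto
    ultimately show "softmin p {N\<in>I. \<kappa> N = M} (\<lambda>N. a (\<kappa> N) + g (frac (real N * z + s)))
        = a M + fibre_min p z g (frac ((s - real M) / z))"
      unfolding f softmin_floor_fibre[OF assms(2,4)] by simp
  qed
  finally show ?thesis by (simp add: I_def \<kappa>_def)
qed

section \<open>Transfer to the renormalized rotation\<close>

text \<open>\<open>f\<close> acts as a logarithmic weight. The sign -1 serves two purposes: positive
  exponents, and the reversal of sides in the step by {1/z}.\<close>

definition birkhoff_min :: "ereal \<Rightarrow> real \<Rightarrow> (real \<Rightarrow> real) \<Rightarrow> real \<Rightarrow> real" where
  "birkhoff_min p \<sigma> f x = softmin p {..<den x} (\<lambda>N. \<sigma> * S N x + f (frac (real N * x)))"

lemma frac_sign_mult_frac: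
  assumes "\<sigma> = 1 \<or> \<sigma> = (-1::real)"
  shows "frac (\<sigma> * (frac x + y)) = frac (\<sigma> * (x + y))"
proof -
  have "\<sigma> * (frac x + y) = \<sigma> * (x + y) - of_int (if \<sigma> = 1 then \<lfloor>x\<rfloor> else - \<lfloor>x\<rfloor>)"
    using assms by (auto simp: frac_def algebra_simps)
  then show ?thesis by (simp only: frac_diff_of_int)
qed

lemma S_sign:
  assumes "\<sigma> = 1 \<or> \<sigma> = (-1::real)" "coprime A Q" "M < A"
  shows "S M (frac (- \<sigma> / (real A / real Q))) = - \<sigma> * S M (1 / (real A / real Q))"
  using assms(1)
proof
  assume "\<sigma> = 1"
  have "real n * (real Q / real A) \<notin> \<int>" if "0 < n" "n \<le> M" for n
    using that assms by (intro mult_divide_not_Ints) (auto simp: coprime_commute)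
  then have "S M (- (real Q / real A)) = - S M (real Q / real A)" by (intro S_minus) auto
  then show ?thesis using \<open>\<sigma> = 1\<close> by simp
qed simp

text \<open>For z = A/Q in lowest terms, N < Q means N z < A, so grouping by M = floor(N z) leaves
  exactly the indices below the denominator A of w = {-\<sigma>/z}. Reciprocity replaces \<sigma>
  S_N(z) by \<sigma> \<open>phi z\<close> plus S_M(w). The fibre offset {-M/z} equals {\<sigma> {M
  w}}, so the inner soft minimum is again a weight in {M w}.\<close>

lemma birkhoff_min_transfer:
  assumes "p < 0" "\<sigma> = 1 \<or> \<sigma> = -1" "z \<in> \<rat>" "0 < z" "z < 1"
  shows "birkhoff_min p \<sigma> f z
    = birkhoff_min p 1 (\<lambda>v. fibre_min p z (\<lambda>\<theta>. \<sigma> * phi z \<theta> + f \<theta>) (frac (\<sigma> * v))) (frac (- \<sigma> / z))"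
proof -
  obtain A Q where AQ: "0 < A" "A < Q" "coprime A Q" "z = real A / real Q"
    using rational_unit_cases[OF assms(3-5)] by blast
  define w where "w = frac (- \<sigma> / z)"
  have "- \<sigma> / z = of_int (if \<sigma> = 1 then - int Q else int Q) / real A"
    using assms(2) AQ by auto
  then have denw: "den w = A"
    unfolding w_def using AQ by (simp only:) (intro den_frac, auto simp: coprime_commute)
  have denz: "den z = Q" using AQ by (simp add: den_of_nat_divide)
  have I: "{N::nat. 0 \<le> real N * z + 0 \<and> real N * z + 0 < real A} = {..<Q}"
  proof -
    have "real N * z < real A \<longleftrightarrow> N < Q" for N
    proof -
      have "real N * z < real A \<longleftrightarrow> real A * real N < real A * real Q"
        using AQ(1,2) unfolding AQ(4) by (simp add: field_simps)
      then show ?thesis using AQ(1) by simp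
    qed
    then show ?thesis using assms(4) by auto
  qed
  have "birkhoff_min p \<sigma> f z = softmin p {..<Q} (\<lambda>N. S (nat \<lfloor>real N * z + 0\<rfloor>) w
        + (\<sigma> * phi z (frac (real N * z + 0)) + f (frac (real N * z + 0))))"
    unfolding birkhoff_min_def denz
  proof (rule softmin_cong[OF refl])
    fix N assume N: "N \<in> {..<Q}"
    have "S N z = phi z (frac (real N * z)) - S (nat \<lfloor>real N * z\<rfloor>) (1 / z)"
    proof (rule S_reciprocity)
      fix n assume "0 < n" "n \<le> N"
      then show "real n * z \<notin> \<int>" unfolding AQ(4) using N AQ by (intro mult_divide_not_Ints) auto
    qed (use assms in auto)
    moreover have "nat \<lfloor>real N * z\<rfloor> < A"
    proof -
      have "N \<in> {N::nat. 0 \<le> real N * z + 0 \<and> real N * z + 0 < real A}" using N I by blast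
      then have "real N * z < A" "0 \<le> real N * z" by simp_all
      then show ?thesis by linarith
    qed
    then have "S (nat \<lfloor>real N * z\<rfloor>) w = - \<sigma> * S (nat \<lfloor>real N * z\<rfloor>) (1 / z)"
      unfolding w_def AQ(4) by (intro S_sign assms AQ)
    ultimately show "\<sigma> * S N z + f (frac (real N * z)) = S (nat \<lfloor>real N * z + 0\<rfloor>) w
        + (\<sigma> * phi z (frac (real N * z + 0)) + f (frac (real N * z + 0)))"
      using assms(2) by (auto simp: algebra_simps)
  qed
  also have "\<dots> = softmin p {..<A} (\<lambda>M. S M w
        + fibre_min p z (\<lambda>\<theta>. \<sigma> * phi z \<theta> + f \<theta>) (frac ((0 - real M) / z)))"
    unfolding I[symmetric] using assms AQ(1) by (intro softmin_floor_decomposition) auto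
  also have "\<dots> = birkhoff_min p 1 (\<lambda>v. fibre_min p z (\<lambda>\<theta>. \<sigma> * phi z \<theta> + f \<theta>) (frac (\<sigma> * v))) w"
    unfolding birkhoff_min_def denw
  proof (rule softmin_cong[OF refl])
    fix M
    have "frac (\<sigma> * frac (real M * w)) = frac (\<sigma> * (real M * (- \<sigma> / z)))"
      using frac_sign_mult_frac[OF assms(2), of "real M * (- \<sigma> / z)" 0] frac_mult_frac[of M "- \<sigma> / z"]
      by (simp add: w_def)
    also have "\<sigma> * (real M * (- \<sigma> / z)) = (0 - real M) / z" using assms(2) by auto
    finally show "S M w + fibre_min p z (\<lambda>\<theta>. \<sigma> * phi z \<theta> + f \<theta>) (frac ((0 - real M) / z)) =
        1 * S M w + fibre_min p z (\<lambda>\<theta>. \<sigma> * phi z \<theta> + f \<theta>) (frac (\<sigma> * frac (real M * w)))" by simp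
  qed
  finally show ?thesis by (simp add: w_def)
qed

section \<open>Transfer of the limiting weights\<close>

lemma S_full_period:
  assumes "coprime d c"
  shows "S (c - 1) (real d / real c) = 0"
proof (cases "c = 0")
  case False
  let ?g = "\<lambda>n. frac (real n * (real d / real c)) - 1/2"
  \<comment> \<open>The reflection n -> c - n negates every centred term.\<close>
  have "sum ?g {1..c-1} = (\<Sum>n=1..c-1. ?g (c - 1 + 1 - n))" by (rule sum.atLeastAtMost_rev)
  also have "\<dots> = (\<Sum>n=1..c-1. - ?g n)"
  proof (rule sum.cong[OF refl])
    fix n assume n: "n \<in> {1..c-1}"
    have "real (c - 1 + 1 - n) * (real d / real c) = - (real n * (real d / real c)) - of_int (- int d)"
      using n False by (subst of_nat_diff) (auto simp: field_simps of_nat_diff)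
    then have "frac (real (c - 1 + 1 - n) * (real d / real c)) = frac (- (real n * (real d / real c)))"
      by (simp only: frac_diff_of_int)
    moreover have "real n * (real d / real c) \<notin> \<int>"
      using n assms by (intro mult_divide_not_Ints) auto
    ultimately show "?g (c - 1 + 1 - n) = - ?g n" by (simp add: frac_neg)
  qed
  finally have "sum ?g {1..c-1} = - sum ?g {1..c-1}" by (simp only: sum_negf)
  then have "sum ?g {1..c-1} = 0" by linarith
  then show ?thesis by (simp only: S_def)
qed simp

text \<open>The conditions 0 <= N c/d + \<sigma>/(2 d) < c with denominators cleared. Multiples of 2
  c are at least 2 apart, so a perturbation by 1 decides only the boundary cases.\<close>

lemma half_shift_iff:
  assumes "0 < (c::nat)"
  shows "2 * real N * real c + 1 < 2 * real c * real d \<longleftrightarrow> N < d"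
    and "2 * real N * real c - 1 < 2 * real c * real d \<longleftrightarrow> N \<le> d"
    and "0 \<le> 2 * real N * real c - 1 \<longleftrightarrow> 0 < N"
proof -
  have c: "real c \<ge> 1" using assms by simp
  have gap: "real c * real i + real c \<le> real c * real j" if "i < j" for i j
    using mult_left_mono[of "real i + 1" "real j" "real c"] that by (simp add: algebra_simps)
  have le: "real c * real i \<le> real c * real j" if "i \<le> j" for i j
    using that by (simp add: mult_left_mono)
  have eq: "2 * real N * real c = 2 * (real c * real N)" "2 * real c * real d = 2 * (real c * real d)"
    by simp_all
  show "2 * real N * real c + 1 < 2 * real c * real d \<longleftrightarrow> N < d"
  proof
    assume "2 * real N * real c + 1 < 2 * real c * real d"
    then show "N < d" using le[of d N] eq by (intro not_le_imp_less notI) linarith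
  next
    assume "N < d"
    then show "2 * real N * real c + 1 < 2 * real c * real d" using gap[of N d] c eq by linarith
  qed
  show "2 * real N * real c - 1 < 2 * real c * real d \<longleftrightarrow> N \<le> d"
  proof
    assume "2 * real N * real c - 1 < 2 * real c * real d"
    then show "N \<le> d" using gap[of d N] c eq by (intro leI notI) linarith
  next
    assume "N \<le> d"
    then show "2 * real N * real c - 1 < 2 * real c * real d" using le[of N d] eq by linarith
  qed
  show "0 \<le> 2 * real N * real c - 1 \<longleftrightarrow> 0 < N"
  proof (cases "N = 0")
    case False
    then have "real c * real N \<ge> 1" using gap[of 0 N] c by linarith
    then have "0 \<le> 2 * real N * real c - 1" using eq(1) by linarith
    then show ?thesis using False by blast
  qed simp
qed

text \<open>
  The shift \<open>\<sigma> / (2 d)\<close> is what remains, in the limit from one side, of the distance to the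
  discontinuities of \<open>frac\<close>. For \<open>\<sigma> = - 1\<close> the admissible indices are \<open>1, \<dots>, d\<close> instead of
  \<open>0, \<dots>, d - 1\<close>; \<open>N mod d\<close> identifies \<open>N = d\<close> with \<open>N = 0\<close>.
\<close>

lemma limit_transfer_value:
  assumes "\<sigma> = 1 \<or> \<sigma> = (-1::real)" "0 < c" "c \<le> d" "coprime c d"
    and "0 \<le> real N * (real c / real d) + \<sigma> / (2 * real d)"
    and "real N * (real c / real d) + \<sigma> / (2 * real d) < real c"
  defines "m \<equiv> nat \<lfloor>real N * (real c / real d) + \<sigma> / (2 * real d)\<rfloor>"
  shows "S m (frac (- \<sigma> / (real c / real d))) + real m / (2 * real c)
       + \<sigma> * phi (real c / real d) (frac (real N * (real c / real d) + \<sigma> / (2 * real d)))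
    = \<sigma> * S (N mod d) (real c / real d) + real (N mod d) / (2 * real d)
       + (2 * real c - 2 * real d + \<sigma>) / (8 * real c * real d)"
proof -
  define z where "z = real c / real d"
  have d: "d > 0" using assms by linarith
  have z: "0 < z" "z \<le> 1" using assms d by (auto simp: z_def)
  have "2 * real N * real c - 1 < 2 * real c * real d"
    using assms(1,6) d by (auto simp: field_simps)
  then have "N \<le> d" using half_shift_iff(2)[OF assms(2)] by blast
  have "N > 0" if "\<sigma> = -1" using assms(5) that d by (cases "N = 0") (auto simp: field_simps)
  have "N < d" if "\<sigma> = 1" using assms(6) that d \<open>N \<le> d\<close> by (cases "N = d") (auto simp: field_simps)
  show ?thesis
  proof (cases "N < d")
    case True
    define r where "r = (N * c) mod d"
    define M where "M = (N * c) div d"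
    have r: "r < d" using d by (simp add: r_def)
    have "N * c = M * d + r" by (simp add: M_def r_def)
    then have "real N * real c = real M * real d + real r" by (metis of_nat_add of_nat_mult)
    then have Nz: "real N * z = real M + real r / real d" using d by (simp add: z_def field_simps)
    have "real r / real d < 1" using r d by simp
    then have fl0: "\<lfloor>real N * z\<rfloor> = int M" using Nz by (intro floor_unique) auto
    then have fr0: "frac (real N * z) = real r / real d" using Nz by (simp add: frac_def)
    have nonint: "real n * z \<notin> \<int>" if "0 < n" "n \<le> N" for n
      unfolding z_def using that True assms by (intro mult_divide_not_Ints) auto
    \<comment> \<open>The shift is negative here, and r = 0 would push the point below the integer M
      and change the floor.\<close>
    have "r > 0" if "\<sigma> = -1"
    proof (rule ccontr)
      assume "\<not> r > 0"
      then have "real N * z = real M" using Nz by simp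
      then show False using nonint[of N] \<open>\<sigma> = -1 \<Longrightarrow> N > 0\<close> that by simp
    qed
    then have rs: "0 \<le> real r / real d + \<sigma> / (2 * real d)" "real r / real d + \<sigma> / (2 * real d) < 1"
      using assms(1) r d by (auto simp: field_simps)
    then have fl: "\<lfloor>real N * z + \<sigma> / (2 * real d)\<rfloor> = int M" using Nz by (intro floor_unique) auto
    then have fr: "frac (real N * z + \<sigma> / (2 * real d)) = real r / real d + \<sigma> / (2 * real d)"
      using Nz by (simp add: frac_def)
    have m: "m = M" using fl by (simp add: m_def z_def)
    have "M < c"
    proof -
      have "N * c < d * c" using True assms by simp
      then show ?thesis by (simp add: M_def less_mult_imp_div_less mult.commute)
    qed
    have "S N z = phi z (real r / real d) - S M (1 / z)"
      using S_reciprocity[OF z nonint] fl0 fr0 by simp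
    moreover have "S M (frac (- \<sigma> / z)) = - \<sigma> * S M (1 / z)"
      unfolding z_def using assms \<open>M < c\<close> by (intro S_sign)
    \<comment> \<open>Expand \<open>phi\<close> around r/d with increment \<sigma>/(2 d). The part
      linear in r/d joins M/(2 c) to form N/(2 d); the remaining 1/(4 d) - 1/(4 c) and the square
      term \<sigma>/(8 c d) make up the constant.\<close>
    moreover have "real M / (2 * real c) + \<sigma> * phi z (real r / real d + \<sigma> / (2 * real d))
      = \<sigma> * phi z (real r / real d) + real N / (2 * real d)
         + (2 * real c - 2 * real d + \<sigma>) / (8 * real c * real d)"
    proof -
      have M: "real M = real N * real c / real d - real r / real d" using Nz by (simp add: z_def)
      show ?thesis
        using assms(1) assms(2) d unfolding M phi_def z_def by (auto simp: field_simps)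
    qed
    ultimately have "S M (frac (- \<sigma> / z)) + real M / (2 * real c) + \<sigma> * phi z (real r / real d + \<sigma> / (2 * real d))
       = \<sigma> * S N z + real N / (2 * real d) + (2 * real c - 2 * real d + \<sigma>) / (8 * real c * real d)"
      using assms(1) by (auto simp: algebra_simps)
    then show ?thesis using True fr m by (simp add: z_def)
  next
    case False
    \<comment> \<open>The index d stands in for 0: its floor is c - 1, where the sum over a full
      period vanishes just as \<open>S 0\<close> does.\<close>
    then have N: "N = d" and \<sigma>: "\<sigma> = -1"
      using \<open>N \<le> d\<close> \<open>\<sigma> = 1 \<Longrightarrow> N < d\<close> assms(1) by auto
    have eq: "real N * z + \<sigma> / (2 * real d) = real (c - 1) + (1 - 1 / (2 * real d))"
      using N \<sigma> assms(2) d by (simp add: z_def of_nat_diff)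
    have fl: "\<lfloor>real N * z + \<sigma> / (2 * real d)\<rfloor> = int (c - 1)"
      unfolding eq using d by (intro floor_unique) (auto simp: field_simps)
    then have fr: "frac (real N * z + \<sigma> / (2 * real d)) = 1 - 1 / (2 * real d)"
      using eq by (simp add: frac_def)
    have m: "m = c - 1" using fl by (simp add: m_def z_def)
    have "S m (frac (- \<sigma> / z)) = 0"
      using S_full_period[of d c] assms(4) m \<sigma> by (simp add: z_def coprime_commute)
    moreover have "real m / (2 * real c) + \<sigma> * phi z (1 - 1 / (2 * real d))
        = (2 * real c - 2 * real d + \<sigma>) / (8 * real c * real d)"
      using \<sigma> assms(2) d by (simp add: m of_nat_diff phi_def z_def field_simps)
    ultimately show ?thesis using N fr by (simp add: z_def)
  qed
qed

text \<open>The limiting weights obey the transfer exactly, up to an additive constant: decomposing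
  with the shift \<sigma>/(2 d) makes the fibre offsets those of the points {m w} + 1/(2 c). This is
  what lets an induction along the renormalization identify the limit.\<close>

lemma limit_transfer:
  assumes "p < 0" "\<sigma> = 1 \<or> \<sigma> = (-1::real)" "0 < c" "c \<le> d" "coprime c d"
  defines "w \<equiv> frac (- \<sigma> / (real c / real d))"
  shows "softmin p {..<c} (\<lambda>m. S m w + real m / (2 * real c)
      + fibre_min p (real c / real d) (\<lambda>\<theta>. \<sigma> * phi (real c / real d) \<theta> + f \<theta>)
          (frac (\<sigma> * (frac (real m * w) + 1 / (2 * real c)))))
    = softmin p {..<d} (\<lambda>N. \<sigma> * S N (real c / real d) + real N / (2 * real d)
        + f (frac (real N * (real c / real d) + \<sigma> / (2 * real d))))
      + (2 * real c - 2 * real d + \<sigma>) / (8 * real c * real d)"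
proof -
  define z where "z = real c / real d"
  define s where "s = \<sigma> / (2 * real d)"
  define C where "C = (2 * real c - 2 * real d + \<sigma>) / (8 * real c * real d)"
  have d: "d > 0" using assms by linarith
  have z: "0 < z" "z \<le> 1" using assms d by (auto simp: z_def)
  have s: "s < z" using assms(2,3) d by (auto simp: s_def z_def field_simps)
  define I where "I = {N::nat. 0 \<le> real N * z + s \<and> real N * z + s < real c}"
  define h where "h N = \<sigma> * S N z + real N / (2 * real d) + f (frac (real N * z + s)) + C" for N
  have "softmin p {..<c} (\<lambda>m. (S m w + real m / (2 * real c))
      + fibre_min p z (\<lambda>\<theta>. \<sigma> * phi z \<theta> + f \<theta>) (frac ((s - real m) / z)))
    = softmin p I (\<lambda>N. (S (nat \<lfloor>real N * z + s\<rfloor>) w + real (nat \<lfloor>real N * z + s\<rfloor>) / (2 * real c))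
        + (\<sigma> * phi z (frac (real N * z + s)) + f (frac (real N * z + s))))"
    unfolding I_def using softmin_floor_decomposition[OF assms(1) z s assms(3), symmetric] .
  also have "\<dots> = softmin p I (\<lambda>N. h (N mod d))"
  proof (rule softmin_cong[OF refl])
    fix N assume "N \<in> I"
    then have "S (nat \<lfloor>real N * z + s\<rfloor>) w + real (nat \<lfloor>real N * z + s\<rfloor>) / (2 * real c) + \<sigma> * phi z (frac (real N * z + s))
      = \<sigma> * S (N mod d) z + real (N mod d) / (2 * real d) + C"
      unfolding I_def s_def z_def w_def C_def using assms by (intro limit_transfer_value) auto
    moreover have "frac (real (N mod d) * z + s) = frac (real N * z + s)"
    proof -
      have "real N = real (N div d) * real d + real (N mod d)"
        by (metis div_mult_mod_eq of_nat_add of_nat_mult)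
      then have "real (N mod d) * z + s = real N * z + s - of_int (int (N div d * c))"
        using d by (simp add: z_def field_simps)
      then show ?thesis by (simp only: frac_diff_of_int)
    qed
    ultimately show "S (nat \<lfloor>real N * z + s\<rfloor>) w + real (nat \<lfloor>real N * z + s\<rfloor>) / (2 * real c)
        + (\<sigma> * phi z (frac (real N * z + s)) + f (frac (real N * z + s))) = h (N mod d)"
      by (simp add: h_def)
  qed
  also have "\<dots> = softmin p {..<d} h"
  proof (rule softmin_reindex)
    have *: "0 \<le> real N * z + s \<longleftrightarrow> 0 \<le> 2 * real N * real c + \<sigma>"
      "real N * z + s < real c \<longleftrightarrow> 2 * real N * real c + \<sigma> < 2 * real c * real d" for N
      using d by (auto simp: z_def s_def field_simps)
    note cd = half_shift_iff[OF assms(3)]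
    show "bij_betw (\<lambda>N. N mod d) I {..<d}"
      using assms(2)
    proof
      assume "\<sigma> = 1"
      then have "I = {..<d}" using * cd by (auto simp: I_def)
      then show ?thesis by (auto simp: bij_betw_def inj_on_def)
    next
      assume "\<sigma> = -1"
      then have I: "I = {1..d}" using * cd by (auto simp: I_def)
      have "N \<in> (\<lambda>N. N mod d) ` {1..d}" if "N < d" for N
        using that d by (cases "N = 0") (auto simp: image_iff intro: bexI[of _ N] bexI[of _ d])
      moreover have "inj_on (\<lambda>N. N mod d) {1..d}"
      proof (rule inj_onI)
        fix x y assume "x \<in> {1..d}" "y \<in> {1..d}" "x mod d = y mod d"
        then show "x = y" by (cases "x = d"; cases "y = d") auto
      qed
      ultimately show ?thesis unfolding I bij_betw_def using d by auto
    qed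
  qed
  also have "\<dots> = softmin p {..<d} (\<lambda>N. \<sigma> * S N z + real N / (2 * real d) + f (frac (real N * z + s))) + C"
    unfolding h_def using assms(1) d by (intro softmin_add_const) auto
  finally have main: "softmin p {..<c} (\<lambda>m. (S m w + real m / (2 * real c))
      + fibre_min p z (\<lambda>\<theta>. \<sigma> * phi z \<theta> + f \<theta>) (frac ((s - real m) / z)))
    = softmin p {..<d} (\<lambda>N. \<sigma> * S N z + real N / (2 * real d) + f (frac (real N * z + s))) + C" .
  have "frac ((s - real m) / z) = frac (\<sigma> * (frac (real m * w) + 1 / (2 * real c)))" for m
  proof -
    have "frac (\<sigma> * (frac (real m * w) + 1 / (2 * real c)))
        = frac (\<sigma> * (real m * (- \<sigma> / z) + 1 / (2 * real c)))"
      using frac_sign_mult_frac[OF assms(2), of "real m * (- \<sigma> / z)"] frac_mult_frac[of m "- \<sigma> / z"]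
      by (simp add: w_def z_def)
    also have "\<sigma> * (real m * (- \<sigma> / z) + 1 / (2 * real c)) = (s - real m) / z"
      using assms(2,3) d by (auto simp: s_def z_def field_simps)
    finally show ?thesis by simp
  qed
  with main show ?thesis by (simp add: z_def s_def C_def)
qed

section \<open>Continuity and concentration of fibre minima\<close>

lemma fibre_min_bound:
  assumes "p < 0" "0 < z" "z \<le> 1" "0 \<le> v" "v < 1" "\<And>\<theta>. 0 \<le> \<theta> \<Longrightarrow> \<theta> < 1 \<Longrightarrow> \<bar>g \<theta>\<bar> \<le> B"
  shows "\<bar>fibre_min p z g v\<bar> \<le> B + (1 / z + 1) * softmin_slack p"
proof -
  note idx = fibre_min_index[OF assms(2-5)]
  have "\<bar>fibre_min p z g v\<bar> \<le> B + card {j::nat. z * (v + real j) < 1} * softmin_slack p"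
    unfolding fibre_min_def using assms by (intro softmin_bound idx) auto
  also have "\<dots> \<le> B + (1 / z + 1) * softmin_slack p"
    using idx(3) softmin_slack_nonneg[OF assms(1)] by (intro add_left_mono mult_right_mono)
  finally show ?thesis .
qed

text \<open>Since no limiting point z0 (v0 + j) equals 1, the index set is eventually constant, and
  a soft minimum over a fixed finite set is continuous. The product filter is needed because the
  weights vary together with the points at which they are evaluated.\<close>

lemma fibre_min_tendsto:
  assumes "p < 0" "(z \<longlongrightarrow> z0) F" "0 < z0" "z0 \<le> 1" "0 < v0" "v0 < 1"
    and "\<And>j::nat. z0 * (v0 + real j) \<noteq> 1"
    and "\<And>j::nat. z0 * (v0 + real j) < 1 \<Longrightarrow>
      ((\<lambda>(i, \<theta>). g i \<theta>) \<longlongrightarrow> g0 (z0 * (v0 + real j))) (F \<times>\<^sub>F nhds (z0 * (v0 + real j)))"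
  shows "((\<lambda>(i, v). fibre_min p (z i) (g i) v) \<longlongrightarrow> fibre_min p z0 g0 v0) (F \<times>\<^sub>F nhds v0)"
proof -
  let ?G = "F \<times>\<^sub>F nhds v0"
  define J0 where "J0 = {j::nat. z0 * (v0 + real j) < 1}"
  have Z: "((\<lambda>x. z (fst x)) \<longlongrightarrow> z0) ?G"
    by (rule filterlim_compose[OF assms(2) filterlim_fst])
  have V: "(snd \<longlongrightarrow> v0) ?G" by (rule filterlim_snd)
  have \<theta>: "((\<lambda>x. z (fst x) * (snd x + real j)) \<longlongrightarrow> z0 * (v0 + real j)) ?G" for j
    by (intro tendsto_intros Z V)
  \<comment> \<open>Once z > z0/2, every j > 2/z0 gives z j > 1, so membership has to be followed
    for finitely many j only.\<close>
  define K where "K = nat \<lceil>2 / z0\<rceil>"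
  have "\<forall>\<^sub>F x in ?G. z (fst x) * (snd x + real j) < 1 \<longleftrightarrow> z0 * (v0 + real j) < 1" for j
  proof (cases "z0 * (v0 + real j) < 1")
    case True
    then show ?thesis using order_tendstoD(2)[OF \<theta> True] by simp
  next
    case False
    then have "z0 * (v0 + real j) > 1" using assms(7)[of j] by simp
    from order_tendstoD(1)[OF \<theta> this] False show ?thesis by (auto elim: eventually_mono)
  qed
  then have "\<forall>\<^sub>F x in ?G. \<forall>j\<in>{..K}. z (fst x) * (snd x + real j) < 1 \<longleftrightarrow> z0 * (v0 + real j) < 1"
    by (intro eventually_ball_finite) auto
  moreover have "\<forall>\<^sub>F x in ?G. z (fst x) > z0 / 2"
    using assms(3) by (intro order_tendstoD(1)[OF Z]) simp
  moreover have "\<forall>\<^sub>F x in ?G. snd x > 0" by (rule order_tendstoD(1)[OF V assms(5)])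
  ultimately have J: "\<forall>\<^sub>F x in ?G. {j::nat. z (fst x) * (snd x + real j) < 1} = J0"
  proof eventually_elim
    case (elim x)
    have "z (fst x) * (snd x + real j) < 1 \<longleftrightarrow> z0 * (v0 + real j) < 1" for j
    proof (cases "j \<le> K")
      case True
      then show ?thesis using elim(1) by simp
    next
      case False
      have large: "y * (u + real j) > 1" if "y > z0 / 2" "u > 0" for y u
      proof -
        have "real j > 2 / z0" using False unfolding K_def by linarith
        then have "z0 / 2 * real j > 1" using assms(3) by (simp add: field_simps)
        also have "z0 / 2 * real j \<le> y * (u + real j)"
          using that assms(3) by (intro mult_mono) auto
        finally show ?thesis .
      qed
      show ?thesis using large[OF elim(2,3)] large[of z0 v0] assms(3,5) by auto
    qed
    then show ?case by (simp add: J0_def)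
  qed
  have "((\<lambda>x. softmin p J0 (\<lambda>j. g (fst x) (z (fst x) * (snd x + real j)))) \<longlongrightarrow>
      softmin p J0 (\<lambda>j. g0 (z0 * (v0 + real j)))) ?G"
  proof (rule softmin_tendsto)
    have "0 \<le> v0" using assms(5) by simp
    from fibre_min_index[OF assms(3,4) this assms(6)] show "finite J0" "J0 \<noteq> {}" by (simp_all add: J0_def)
    fix j assume "j \<in> J0"
    then have "z0 * (v0 + real j) < 1" by (simp add: J0_def)
    from filterlim_compose[OF assms(8)[OF this] filterlim_Pair[OF filterlim_fst \<theta>]]
    show "((\<lambda>x. g (fst x) (z (fst x) * (snd x + real j))) \<longlongrightarrow> g0 (z0 * (v0 + real j))) ?G" by simp
  qed (fact assms(1))
  moreover have "\<forall>\<^sub>F x in ?G. (case x of (i, v) \<Rightarrow> fibre_min p (z i) (g i) v)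
      = softmin p J0 (\<lambda>j. g (fst x) (z (fst x) * (snd x + real j)))"
    using J by eventually_elim (auto simp: fibre_min_def split: prod.split intro!: softmin_cong)
  ultimately show ?thesis
    by (simp only: tendsto_cong) (simp add: fibre_min_def J0_def)
qed

text \<open>At most 1/z + 1 indices are discarded, each at a relative cost exponentially small in
  1/z; the substitution y = a/z turns this into powers of y over exp y.\<close>

lemma softmin_error_tendsto_0:
  assumes "p < 0" "k > 0"
  shows "((\<lambda>z. softmin_error p (1 / z + 1) (k / z - D)) \<longlongrightarrow> 0) (at_right 0)"
  using assms(1)
proof (cases rule: negative_ereal_cases)
  case (1 t)
  define a where "a = - t * k"
  have a: "a > 0" using 1 assms(2) by (simp add: a_def mult_neg_pos)
  have inv: "filterlim (\<lambda>z::real. a / z) at_top (at_right 0)"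
    using filterlim_tendsto_pos_mult_at_top[OF tendsto_const a filterlim_inverse_at_top_right]
    by (simp add: divide_inverse)
  have "((\<lambda>y::real. (1 / a * (y ^ 1 / exp y) + y ^ 0 / exp y) * (exp (- t * D) / (- t))) \<longlongrightarrow>
      (1 / a * 0 + 0) * (exp (- t * D) / (- t))) at_top"
    by (intro tendsto_intros tendsto_power_div_exp_0)
  from filterlim_compose[OF this inv]
  have "((\<lambda>z::real. (1 / a * ((a / z) ^ 1 / exp (a / z)) + (a / z) ^ 0 / exp (a / z)) * (exp (- t * D) / (- t))) \<longlongrightarrow> 0)
      (at_right 0)" by simp
  moreover have "(1 / a * ((a / z) ^ 1 / exp (a / z)) + (a / z) ^ 0 / exp (a / z)) * (exp (- t * D) / (- t))
      = softmin_error p (1 / z + 1) (k / z - D)" for z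
  proof -
    have "exp (t * (k / z - D)) = exp (- t * D) / exp (a / z)"
      by (simp add: a_def algebra_simps flip: exp_diff)
    then show ?thesis using 1 a by (simp add: add_divide_distrib distrib_right)
  qed
  ultimately show ?thesis by simp
qed simp

lemma phi_complete_square:
  "z > 0 \<Longrightarrow> phi z \<theta> = (\<theta> - 1/2)\<^sup>2 / (2 * z) + \<theta> / 2 - 1 / (8 * z)"
  by (simp add: phi_def field_simps power2_eq_square)

text \<open>
  As \<open>z\<close> tends to \<open>0\<close>, the parabola \<open>phi z\<close> becomes arbitrarily steep around its minimum near \<open>1/2\<close>,
  uniformly in the offset \<open>v\<close>.
\<close>

lemma fibre_min_concentration:
  assumes "p < 0" "0 < \<eta>" "0 < e" "0 \<le> B"
  shows "\<forall>\<^sub>F z in at_right 0. \<forall>v f c. 0 \<le> v \<longrightarrow> v < 1 \<longrightarrow>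
      (\<forall>\<theta>. 0 \<le> \<theta> \<longrightarrow> \<theta> < 1 \<longrightarrow> \<bar>f \<theta>\<bar> \<le> B) \<longrightarrow> (\<forall>\<theta>. \<bar>\<theta> - 1/2\<bar> < \<eta> \<longrightarrow> \<bar>f \<theta> - c\<bar> \<le> e) \<longrightarrow>
      \<bar>fibre_min p z (\<lambda>\<theta>. phi z \<theta> + f \<theta>) v - (fibre_min p z (phi z) v + c)\<bar> \<le> 3 * e"
proof -
  \<comment> \<open>Away from the window the square (\<theta> - 1/2)^2 is at least \<eta>^2, at the
    kept point at most (\<eta>/2)^2; over 2 z the difference is 3 \<eta>^2/(8 z). The term
    \<theta>/2 of the parabola costs at most 1/2 and the two values of f at most 2 B.\<close>
  define D where "D z = 3 * \<eta>\<^sup>2 / 8 / z - (1/2 + 2 * B)" for z :: real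
  have k: "3 * \<eta>\<^sup>2 / 8 > 0" using assms by simp
  have "\<forall>\<^sub>F z in at_right 0. softmin_error p (1 / z + 1) (D z) < e"
    unfolding D_def by (rule order_tendstoD(2)[OF softmin_error_tendsto_0[OF assms(1) k] assms(3)])
  moreover have "\<forall>\<^sub>F z in at_right 0. 0 < z \<and> z < Min {\<eta> / 2, 1/2, 3 * \<eta>\<^sup>2 / 8 / (1/2 + 2 * B)}"
    using assms k by (intro eventually_conj eventually_at_right_real eventually_at_right_less
        order_tendstoD(2)[OF tendsto_ident_at]) (auto simp: add_pos_nonneg)
  ultimately show ?thesis
  proof eventually_elim
    case (elim z)
    then have z: "0 < z" "z < \<eta> / 2" "z < 1/2" "z < 3 * \<eta>\<^sup>2 / 8 / (1/2 + 2 * B)" by auto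
    then have "z \<le> 1" by simp
    have D0: "D z \<ge> 0"
      using z assms(4) by (simp add: D_def field_simps add_pos_nonneg)
    show ?case
    proof (intro allI impI)
      fix v c :: real and f :: "real \<Rightarrow> real"
      assume v: "0 \<le> v" "v < 1" and fB: "\<forall>\<theta>. 0 \<le> \<theta> \<longrightarrow> \<theta> < 1 \<longrightarrow> \<bar>f \<theta>\<bar> \<le> B"
        and fc: "\<forall>\<theta>. \<bar>\<theta> - 1/2\<bar> < \<eta> \<longrightarrow> \<bar>f \<theta> - c\<bar> \<le> e"
      define J where "J = {j::nat. z * (v + real j) < 1}"
      define \<theta> where "\<theta> j = z * (v + real j)" for j :: nat
      define K where "K = {j \<in> J. \<bar>\<theta> j - 1/2\<bar> \<ge> \<eta>}"
      note idx = fibre_min_index[OF z(1) \<open>z \<le> 1\<close> v, folded J_def]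
      have range: "0 \<le> \<theta> j" "\<theta> j < 1" if "j \<in> J" for j
        using that z v by (auto simp: J_def \<theta>_def)
      \<comment> \<open>Fibre points are spaced by z, so one of them lies within z of 1/2 whatever
        the offset, and z < \<eta>/2 puts it inside the window.\<close>
      define j0 where "j0 = nat \<lfloor>1 / (2 * z)\<rfloor>"
      have "real j0 \<le> 1 / (2 * z)" "1 / (2 * z) - 1 < real j0"
        using z(1) unfolding j0_def by (auto simp: of_nat_nat)
      then have "z * real j0 \<le> 1/2" "1/2 - z < z * real j0"
        using z(1) by (simp_all add: field_simps)
      moreover have "0 \<le> z * v" "z * v < z" using z v by auto
      ultimately have j0: "\<bar>\<theta> j0 - 1/2\<bar> \<le> z"
        unfolding \<theta>_def distrib_left by linarith
      show "\<bar>fibre_min p z (\<lambda>\<theta>. phi z \<theta> + f \<theta>) v - (fibre_min p z (phi z) v + c)\<bar> \<le> 3 * e"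
      proof -
        have "j0 \<in> J" using j0 z by (simp add: J_def \<theta>_def[symmetric] abs_le_iff)
        then have j0K: "j0 \<in> J - K" using j0 z by (simp add: K_def)
        have lower: "phi z (\<theta> j) \<ge> phi z (\<theta> j0) + (D z + 2 * B)" if "j \<in> K" for j
        proof -
          have "(\<theta> j - 1/2)\<^sup>2 \<ge> \<eta>\<^sup>2"
            using that assms(2) by (auto simp: K_def intro: power2_le_iff_abs_le[THEN iffD2] abs_le_square_iff[THEN iffD1])
          moreover have "(\<theta> j0 - 1/2)\<^sup>2 \<le> (\<eta> / 2)\<^sup>2"
            using j0 z assms(2) by (intro abs_le_square_iff[THEN iffD1]) auto
          ultimately have "(\<theta> j - 1/2)\<^sup>2 - (\<theta> j0 - 1/2)\<^sup>2 \<ge> 3 * \<eta>\<^sup>2 / 4"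
            by (simp add: power_divide)
          then have "((\<theta> j - 1/2)\<^sup>2 - (\<theta> j0 - 1/2)\<^sup>2) / (2 * z) \<ge> 3 * \<eta>\<^sup>2 / 4 / (2 * z)"
            using z by (intro divide_right_mono) auto
          moreover have "\<theta> j - \<theta> j0 \<ge> -1"
            using range[of j] range[of j0] \<open>j0 \<in> J\<close> that by (simp add: K_def)
          ultimately show ?thesis
            by (simp add: phi_complete_square[OF z(1)] D_def diff_divide_distrib)
        qed
        have lower': "phi z (\<theta> j) + f (\<theta> j) \<ge> phi z (\<theta> j0) + f (\<theta> j0) + D z" if "j \<in> K" for j
        proof -
          have "\<bar>f (\<theta> j)\<bar> \<le> B" "\<bar>f (\<theta> j0)\<bar> \<le> B"
            using that \<open>j0 \<in> J\<close> range fB by (auto simp: K_def)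
          then show ?thesis using lower[OF that] by linarith
        qed
        have "K \<subseteq> J" by (auto simp: K_def)
        have card: "real (card K) \<le> 1 / z + 1"
          using card_mono[OF idx(1) \<open>K \<subseteq> J\<close>] idx(3) by linarith
        have fin: "finite (J - K)" "J - K \<noteq> {}" using idx(1) j0K by auto
        \<comment> \<open>Three errors of size e: restricting to the window with f, restricting
          without f, and replacing f by c on the window.\<close>
        have "\<bar>softmin p J (\<lambda>j. phi z (\<theta> j) + f (\<theta> j)) - softmin p (J - K) (\<lambda>j. phi z (\<theta> j) + f (\<theta> j))\<bar>
            \<le> softmin_error p (1 / z + 1) (D z)"
          by (rule softmin_drop[OF assms(1) idx(1) \<open>K \<subseteq> J\<close> j0K D0 _ card]) (rule lower')
        moreover have "\<bar>softmin p J (\<lambda>j. phi z (\<theta> j)) - softmin p (J - K) (\<lambda>j. phi z (\<theta> j))\<bar>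
            \<le> softmin_error p (1 / z + 1) (D z)"
          using lower assms(4)
          by (intro softmin_drop[OF assms(1) idx(1) \<open>K \<subseteq> J\<close> j0K D0 _ card]) fastforce
        moreover have "\<bar>softmin p (J - K) (\<lambda>j. phi z (\<theta> j) + f (\<theta> j)) - softmin p (J - K) (\<lambda>j. phi z (\<theta> j) + c)\<bar> \<le> e"
          using fc by (intro softmin_near[OF assms(1) fin]) (auto simp: K_def)
        moreover have "softmin p (J - K) (\<lambda>j. phi z (\<theta> j) + c) = softmin p (J - K) (\<lambda>j. phi z (\<theta> j)) + c"
          by (rule softmin_add_const[OF assms(1) fin])
        moreover have "fibre_min p z g v = softmin p J (\<lambda>j. g (\<theta> j))" for g
          by (simp add: fibre_min_def J_def \<theta>_def)
        ultimately show ?thesis using elim(1) by simp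
      qed
    qed
  qed
qed

section \<open>One-sided limits of soft minima\<close>

definition limit_min :: "ereal \<Rightarrow> real \<Rightarrow> (real \<Rightarrow> real) \<Rightarrow> nat \<Rightarrow> nat \<Rightarrow> real" where
  "limit_min p \<sigma> f c d = softmin p {..<d} (\<lambda>N. \<sigma> * S N (real c / real d) + real N / (2 * real d)
     + f (frac (real N * (real c / real d) + \<sigma> / (2 * real d))))"

text \<open>
  The convergence \<open>f i \<rightarrow> f0\<close> is needed only near the finitely many points on which the limit
  measure is supported (\<open>n\<close> enters only modulo \<open>d\<close>).
\<close>

definition tame :: "'i filter \<Rightarrow> ('i \<Rightarrow> real \<Rightarrow> real) \<Rightarrow> (real \<Rightarrow> real) \<Rightarrow> real \<Rightarrow> nat \<Rightarrow> nat \<Rightarrow> bool" where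
  "tame F f f0 \<sigma> c d \<longleftrightarrow>
     (\<exists>B. \<forall>\<^sub>F i in F. \<forall>\<theta>. 0 \<le> \<theta> \<longrightarrow> \<theta> < 1 \<longrightarrow> \<bar>f i \<theta>\<bar> \<le> B) \<and>
     (\<forall>n::int. ((\<lambda>(i, \<theta>). f i \<theta>) \<longlongrightarrow> f0 (frac (of_int n * (real c / real d) + \<sigma> / (2 * real d))))
        (F \<times>\<^sub>F nhds (frac (of_int n * (real c / real d) + \<sigma> / (2 * real d)))))"

definition right_limit_law :: "ereal \<Rightarrow> 'i filter \<Rightarrow> nat \<Rightarrow> nat \<Rightarrow> bool" where
  "right_limit_law p F b d \<longleftrightarrow> (\<forall>x f f0.
     (x \<longlongrightarrow> real b / real d) F \<longrightarrow> (\<forall>\<^sub>F i in F. x i \<in> \<rat> \<and> real b / real d < x i) \<longrightarrow>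
     tame F f f0 1 b d \<longrightarrow>
     ((\<lambda>i. birkhoff_min p 1 (f i) (x i) - birkhoff_min p 1 (\<lambda>_. 0) (x i)) \<longlongrightarrow>
        limit_min p 1 f0 b d - limit_min p 1 (\<lambda>_. 0) b d) F)"

lemma tame_zero: "tame F (\<lambda>_ _. 0) (\<lambda>_. 0) \<sigma> c d"
  by (auto simp: tame_def case_prod_unfold intro!: exI[of _ 0])

text \<open>The fractional part is right continuous everywhere, integers included, and increasing to
  the right of each point; hence the preference for approach from the right.\<close>

lemma frac_tendsto_right:
  fixes y :: "'i \<Rightarrow> real"
  assumes "(y \<longlongrightarrow> y0) F" "\<forall>\<^sub>F i in F. y0 < y i"
  shows "((\<lambda>i. frac (y i)) \<longlongrightarrow> frac y0) F" "\<forall>\<^sub>F i in F. frac y0 < frac (y i)"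
proof -
  have "\<forall>\<^sub>F i in F. y i < of_int \<lfloor>y0\<rfloor> + 1"
    by (rule order_tendstoD(2)[OF assms(1)]) linarith
  with assms(2) have fr: "\<forall>\<^sub>F i in F. frac (y i) = y i - of_int \<lfloor>y0\<rfloor> \<and> y0 < y i"
  proof eventually_elim
    case (elim i)
    have "of_int \<lfloor>y0\<rfloor> \<le> y0" by simp
    then have "\<lfloor>y i\<rfloor> = \<lfloor>y0\<rfloor>" using elim by (intro floor_unique) linarith+
    then show ?case using elim by (simp add: frac_def)
  qed
  have "((\<lambda>i. y i - of_int \<lfloor>y0\<rfloor>) \<longlongrightarrow> frac y0) F"
    unfolding frac_def by (intro tendsto_intros assms(1))
  moreover have "\<forall>\<^sub>F i in F. frac (y i) = y i - of_int \<lfloor>y0\<rfloor>" using fr by eventually_elim simp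
  ultimately show "((\<lambda>i. frac (y i)) \<longlongrightarrow> frac y0) F" by (simp add: tendsto_cong)
  show "\<forall>\<^sub>F i in F. frac y0 < frac (y i)"
    using fr by eventually_elim (simp add: frac_def)
qed

text \<open>The map z -> -\<sigma>/z is increasing for \<sigma> = 1 and decreasing for \<sigma> =
  -1, so with the side chosen by \<sigma> the image always approaches from the right.\<close>

lemma renormalized_tendsto_right:
  assumes "\<sigma> = 1 \<or> \<sigma> = (-1::real)" "0 < z0" "(z \<longlongrightarrow> z0) F"
    and "\<forall>\<^sub>F i in F. z i \<in> \<rat> \<and> 0 < z i \<and> 0 < \<sigma> * (z i - z0)"
  shows "((\<lambda>i. frac (- \<sigma> / z i)) \<longlongrightarrow> frac (- \<sigma> / z0)) F"
    and "\<forall>\<^sub>F i in F. frac (- \<sigma> / z i) \<in> \<rat> \<and> frac (- \<sigma> / z0) < frac (- \<sigma> / z i)"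
proof -
  have lim: "((\<lambda>i. - \<sigma> / z i) \<longlongrightarrow> - \<sigma> / z0) F"
    using assms(2) by (intro tendsto_intros assms(3)) auto
  have "\<forall>\<^sub>F i in F. - \<sigma> / z0 < - \<sigma> / z i"
    using assms(4)
  proof eventually_elim
    case (elim i)
    then show ?case using assms(1,2) by (auto simp: divide_simps)
  qed
  note right = frac_tendsto_right[OF lim this]
  show "((\<lambda>i. frac (- \<sigma> / z i)) \<longlongrightarrow> frac (- \<sigma> / z0)) F" by (rule right(1))
  show "\<forall>\<^sub>F i in F. frac (- \<sigma> / z i) \<in> \<rat> \<and> frac (- \<sigma> / z0) < frac (- \<sigma> / z i)"
    using right(2) assms(4) by eventually_elim (use assms(1) in auto)
qed

section \<open>Support points of the limiting weights\<close>

lemma half_odd_neq: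
  assumes "\<sigma> = 1 \<or> \<sigma> = (-1::real)"
  shows "of_int k + \<sigma> / 2 \<noteq> of_int l"
proof
  assume *: "of_int k + \<sigma> / 2 = of_int l"
  define s :: int where "s = (if \<sigma> = 1 then 1 else -1)"
  have "\<sigma> = of_int s" using assms by (auto simp: s_def)
  then have "real_of_int (2 * k + s) = of_int (2 * l)" using * by simp
  then have "2 * k + s = 2 * l" by (simp only: of_int_eq_iff)
  then show False by (auto simp: s_def split: if_splits) presburger+
qed

text \<open>The fibre over a support point at e/c consists of support points at c/d, so convergence
  of the weight is known exactly where it is needed. All of them are half-odd multiples of 1/d and
  thus avoid integers, by parity.\<close>

lemma fibre_points:
  fixes n :: int
  assumes "\<sigma> = 1 \<or> \<sigma> = (-1::real)" "0 < c" "c \<le> d"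
  defines "z0 \<equiv> real c / real d"
  assumes "frac (- \<sigma> / z0) = real e / real c"
  defines "u \<equiv> frac (of_int n * (real e / real c) + 1 / (2 * real c))"
  defines "v0 \<equiv> frac (\<sigma> * u)"
  shows "0 < v0" "\<sigma> * u \<notin> \<int>"
    and "\<exists>k::int. \<forall>j::nat. z0 * (v0 + real j) = of_int (int j - k) * z0 + \<sigma> / (2 * real d) - of_int n"
    and "z0 * (v0 + real j) \<noteq> 1"
proof -
  have d: "d > 0" using assms(2,3) by linarith
  \<comment> \<open>This is (s - n)/z0 with s = \<sigma>/(2 d), the number whose fractional part is
    the fibre offset.\<close>
  define y where "y = (\<sigma> / 2 - of_int (n * int d)) / real c"
  define m where "m = \<lfloor>- \<sigma> / z0\<rfloor>"
  have "real e / real c = - \<sigma> / z0 - of_int m" using assms(5) by (simp add: frac_def m_def)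
  then have "\<sigma> * (of_int n * (real e / real c) + 1 / (2 * real c))
      = \<sigma> * (of_int n * (- \<sigma> / z0 - of_int m) + 1 / (2 * real c))" by (simp only:)
  also have "\<dots> = y - of_int ((if \<sigma> = 1 then 1 else -1) * n * m)"
    using assms(1,2) d by (auto simp: y_def z0_def field_simps)
  finally have "\<sigma> * (of_int n * (real e / real c) + 1 / (2 * real c))
      = y - of_int ((if \<sigma> = 1 then 1 else -1) * n * m)" .
  then have v0: "v0 = frac y"
    unfolding v0_def u_def using frac_sign_mult_frac[OF assms(1), of "of_int n * (real e / real c) + 1 / (2 * real c)" 0]
    by (simp only: add_0_right frac_diff_of_int)
  have "y \<noteq> of_int l" for l
  proof
    assume "y = of_int l"
    then have "of_int (- (n * int d)) + \<sigma> / 2 = of_int (l * int c)"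
      using assms(2) by (simp add: y_def field_simps)
    then show False using half_odd_neq[OF assms(1)] by blast
  qed
  then have "y \<notin> \<int>" by (auto elim: Ints_cases)
  then have "v0 \<noteq> 0" by (simp add: v0 frac_eq_0_iff)
  then show "0 < v0" unfolding v0_def using frac_ge_0[of "\<sigma> * u"] by linarith
  show "\<sigma> * u \<notin> \<int>" using \<open>v0 \<noteq> 0\<close> by (simp add: v0_def frac_eq_0_iff)
  have pt: "z0 * (v0 + real j) = of_int (int j - \<lfloor>y\<rfloor>) * z0 + \<sigma> / (2 * real d) - of_int n" for j
    using assms(2) d unfolding v0 frac_def by (simp add: y_def z0_def field_simps)
  then show "\<exists>k::int. \<forall>j::nat. z0 * (v0 + real j) = of_int (int j - k) * z0 + \<sigma> / (2 * real d) - of_int n"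
    by blast
  show "z0 * (v0 + real j) \<noteq> 1"
  proof
    assume "z0 * (v0 + real j) = 1"
    then have "of_int (int j - \<lfloor>y\<rfloor>) * z0 + \<sigma> / (2 * real d) - of_int n = 1" using pt[of j] by metis
    then have "of_int ((int j - \<lfloor>y\<rfloor>) * int c - n * int d) + \<sigma> / 2 = of_int (int d)"
      using d by (simp add: z0_def field_simps)
    then show False using half_odd_neq[OF assms(1)] by blast
  qed
qed

lemma phi_bound:
  assumes "0 < z" "0 \<le> \<theta>" "\<theta> < 1"
  shows "\<bar>phi z \<theta>\<bar> \<le> 1 / 2 + 1 / (2 * z)"
proof -
  have "\<theta> * (1 - \<theta>) \<le> 1 * 1" using assms by (intro mult_mono) auto
  then have "\<theta> * (1 - \<theta>) / (2 * z) \<le> 1 / (2 * z)" using assms by (intro divide_right_mono) auto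
  moreover have "0 \<le> \<theta> * (1 - \<theta>) / (2 * z)" using assms by simp
  ultimately show ?thesis using assms unfolding phi_def by linarith
qed

lemma limit_min_transfer:
  assumes "p < 0" "\<sigma> = 1 \<or> \<sigma> = (-1::real)" "0 < c" "c \<le> d" "coprime c d"
    and "frac (- \<sigma> / (real c / real d)) = real e / real c"
  shows "limit_min p 1 (\<lambda>v. fibre_min p (real c / real d) (\<lambda>\<theta>. \<sigma> * phi (real c / real d) \<theta> + f \<theta>) (frac (\<sigma> * v))) e c
    = limit_min p \<sigma> f c d + (2 * real c - 2 * real d + \<sigma>) / (8 * real c * real d)"
proof -
  have "frac (\<sigma> * frac (real N * (real e / real c) + 1 / (2 * real c)))
      = frac (\<sigma> * (frac (real N * (real e / real c)) + 1 / (2 * real c)))" for N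
    using frac_sign_mult_frac[OF assms(2), of "real N * (real e / real c) + 1 / (2 * real c)" 0]
      frac_sign_mult_frac[OF assms(2), of "real N * (real e / real c)"] by simp
  then show ?thesis
    using limit_transfer[OF assms(1-5), of f] unfolding limit_min_def assms(6) by simp
qed

text \<open>Tameness survives a transfer: z stays away from 0, which bounds both
  \<open>phi z\<close> and the number of fibre points, and the limiting fibres avoid the jumps of
  \<open>frac\<close> and of the index set.\<close>

lemma tame_fibre_min:
  assumes "p < 0" "\<sigma> = 1 \<or> \<sigma> = (-1::real)" "0 < c" "c \<le> d"
    and lim: "(z \<longlongrightarrow> real c / real d) F" and z: "\<forall>\<^sub>F i in F. 0 < z i \<and> z i < 1"
    and tame: "tame F f f0 \<sigma> c d"
    and w: "frac (- \<sigma> / (real c / real d)) = real e / real c"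
  shows "tame F (\<lambda>i v. fibre_min p (z i) (\<lambda>\<theta>. \<sigma> * phi (z i) \<theta> + f i \<theta>) (frac (\<sigma> * v)))
    (\<lambda>v. fibre_min p (real c / real d) (\<lambda>\<theta>. \<sigma> * phi (real c / real d) \<theta> + f0 \<theta>) (frac (\<sigma> * v))) 1 e c"
  unfolding tame_def
proof (intro conjI allI)
  define z0 where "z0 = real c / real d"
  have d: "d > 0" using assms(3,4) by linarith
  have z0: "0 < z0" "z0 \<le> 1" using assms(3,4) d by (auto simp: z0_def)
  obtain B where B: "\<forall>\<^sub>F i in F. \<forall>\<theta>. 0 \<le> \<theta> \<longrightarrow> \<theta> < 1 \<longrightarrow> \<bar>f i \<theta>\<bar> \<le> B"
    using tame by (auto simp: tame_def)
  have "\<forall>\<^sub>F i in F. z0 / 2 < z i" using z0 by (intro order_tendstoD(1)[OF lim[folded z0_def]]) simp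
  with B z have "\<forall>\<^sub>F i in F. \<forall>v. 0 \<le> v \<longrightarrow> v < 1 \<longrightarrow>
    \<bar>fibre_min p (z i) (\<lambda>\<theta>. \<sigma> * phi (z i) \<theta> + f i \<theta>) (frac (\<sigma> * v))\<bar>
      \<le> 1 / 2 + 1 / z0 + B + (2 / z0 + 1) * softmin_slack p"
  proof eventually_elim
    case (elim i)
    have "\<bar>fibre_min p (z i) (\<lambda>\<theta>. \<sigma> * phi (z i) \<theta> + f i \<theta>) v\<bar>
      \<le> 1 / 2 + 1 / (2 * z i) + B + (1 / z i + 1) * softmin_slack p" if v: "0 \<le> v" "v < 1" for v
    proof (rule fibre_min_bound[OF assms(1) _ _ v])
      fix \<theta> :: real assume \<theta>: "0 \<le> \<theta>" "\<theta> < 1"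
      have "\<bar>\<sigma> * phi (z i) \<theta>\<bar> \<le> 1 / 2 + 1 / (2 * z i)"
        using phi_bound[OF _ \<theta>] elim assms(2) by auto
      moreover have "\<bar>f i \<theta>\<bar> \<le> B" using elim \<theta> by blast
      ultimately show "\<bar>\<sigma> * phi (z i) \<theta> + f i \<theta>\<bar> \<le> 1 / 2 + 1 / (2 * z i) + B" by linarith
    qed (use elim in auto)
    moreover have "1 / z i \<le> 2 / z0" using elim z0 by (simp add: field_simps)
    then have "1 / (2 * z i) \<le> 1 / z0" "(1 / z i + 1) * softmin_slack p \<le> (2 / z0 + 1) * softmin_slack p"
      using softmin_slack_nonneg[OF assms(1)] by (auto intro: mult_right_mono)
    ultimately show ?case by (smt (verit) frac_ge_0 frac_lt_1)
  qed
  then show "\<exists>B. \<forall>\<^sub>F i in F. \<forall>v. 0 \<le> v \<longrightarrow> v < 1 \<longrightarrow>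
      \<bar>fibre_min p (z i) (\<lambda>\<theta>. \<sigma> * phi (z i) \<theta> + f i \<theta>) (frac (\<sigma> * v))\<bar> \<le> B" by blast
  fix n :: int
  define u where "u = frac (of_int n * (real e / real c) + 1 / (2 * real c))"
  define v0 where "v0 = frac (\<sigma> * u)"
  note pts = fibre_points[OF assms(2-4) w, of n, folded z0_def u_def, folded v0_def]
  have "((\<lambda>(i, v). fibre_min p (z i) (\<lambda>\<theta>. \<sigma> * phi (z i) \<theta> + f i \<theta>) v) \<longlongrightarrow>
      fibre_min p z0 (\<lambda>\<theta>. \<sigma> * phi z0 \<theta> + f0 \<theta>) v0) (F \<times>\<^sub>F nhds v0)"
  proof (rule fibre_min_tendsto[OF assms(1) lim[folded z0_def] z0 pts(1)])
    show "v0 < 1" by (simp add: v0_def frac_lt_1)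
    show "z0 * (v0 + real j) \<noteq> 1" for j by (rule pts(4))
    fix j :: nat assume lt1: "z0 * (v0 + real j) < 1"
    define \<theta> where "\<theta> = z0 * (v0 + real j)"
    obtain k where k: "\<theta> = of_int (int j - k) * z0 + \<sigma> / (2 * real d) - of_int n"
      using pts(3) \<theta>_def by blast
    have "0 \<le> \<theta>" using z0 pts(1) by (simp add: \<theta>_def)
    then have "frac (of_int (int j - k) * z0 + \<sigma> / (2 * real d)) = \<theta>"
      using lt1 k by (simp add: frac_unique_iff flip: \<theta>_def)
    then have f: "((\<lambda>(i, \<theta>). f i \<theta>) \<longlongrightarrow> f0 \<theta>) (F \<times>\<^sub>F nhds \<theta>)"
      using tame unfolding tame_def z0_def by metis
    have "((\<lambda>x. z (fst x)) \<longlongrightarrow> z0) (F \<times>\<^sub>F nhds \<theta>)"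
      by (rule filterlim_compose[OF lim[folded z0_def] filterlim_fst])
    moreover have "(snd \<longlongrightarrow> \<theta>) (F \<times>\<^sub>F nhds \<theta>)" by (rule filterlim_snd)
    ultimately have "((\<lambda>x. \<sigma> * phi (z (fst x)) (snd x)) \<longlongrightarrow> \<sigma> * phi z0 \<theta>) (F \<times>\<^sub>F nhds \<theta>)"
      unfolding phi_def using z0 by (intro tendsto_intros) auto
    from tendsto_add[OF this f]
    show "((\<lambda>(i, \<theta>). \<sigma> * phi (z i) \<theta> + f i \<theta>) \<longlongrightarrow> \<sigma> * phi z0 (z0 * (v0 + real j)) + f0 (z0 * (v0 + real j)))
        (F \<times>\<^sub>F nhds (z0 * (v0 + real j)))"
      by (simp add: case_prod_unfold flip: \<theta>_def)
  qed
  moreover have "((\<lambda>x. frac (\<sigma> * snd x)) \<longlongrightarrow> v0) (F \<times>\<^sub>F nhds u)"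
  proof -
    have "((\<lambda>x. \<sigma> * snd x) \<longlongrightarrow> \<sigma> * u) (F \<times>\<^sub>F nhds u)" by (intro tendsto_intros filterlim_snd)
    from isCont_tendsto_compose[OF continuous_frac[OF pts(2)] this] show ?thesis by (simp add: v0_def)
  qed
  from filterlim_compose[OF calculation filterlim_Pair[OF filterlim_fst this]]
  show "((\<lambda>(i, v). fibre_min p (z i) (\<lambda>\<theta>. \<sigma> * phi (z i) \<theta> + f i \<theta>) (frac (\<sigma> * v))) \<longlongrightarrow>
      fibre_min p (real c / real d) (\<lambda>\<theta>. \<sigma> * phi (real c / real d) \<theta> + f0 \<theta>)
        (frac (\<sigma> * frac (of_int n * (real e / real c) + 1 / (2 * real c)))))
      (F \<times>\<^sub>F nhds (frac (of_int n * (real e / real c) + 1 / (2 * real c))))"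
    by (simp add: case_prod_unfold u_def v0_def z0_def)
qed

text \<open>The limit is taken relative to the unweighted soft minimum at the renormalized point, so
  consecutive steps telescope.\<close>

lemma birkhoff_min_step:
  assumes "p < 0" "\<sigma> = 1 \<or> \<sigma> = (-1::real)" "0 < c" "c \<le> d" "coprime c d"
    and "(z \<longlongrightarrow> real c / real d) F"
    and z: "\<forall>\<^sub>F i in F. z i \<in> \<rat> \<and> 0 < z i \<and> z i < 1 \<and> 0 < \<sigma> * (z i - real c / real d)"
    and "tame F f f0 \<sigma> c d"
    and w: "frac (- \<sigma> / (real c / real d)) = real e / real c"
    and "right_limit_law p F e c"
  shows "((\<lambda>i. birkhoff_min p \<sigma> (f i) (z i) - birkhoff_min p 1 (\<lambda>_. 0) (frac (- \<sigma> / z i))) \<longlongrightarrow>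
      limit_min p \<sigma> f0 c d + (2 * real c - 2 * real d + \<sigma>) / (8 * real c * real d)
        - limit_min p 1 (\<lambda>_. 0) e c) F"
proof -
  have z': "\<forall>\<^sub>F i in F. z i \<in> \<rat> \<and> 0 < z i \<and> 0 < \<sigma> * (z i - real c / real d)"
    "\<forall>\<^sub>F i in F. 0 < z i \<and> z i < 1"
    using z by (auto elim: eventually_mono)
  have "real c / real d > 0" using assms(3,4) by simp
  note ren = renormalized_tendsto_right[OF assms(2) this assms(6) z'(1), unfolded w]
  note tame = tame_fibre_min[OF assms(1-4,6) z'(2) assms(8) w]
  have "\<forall>\<^sub>F i in F. birkhoff_min p \<sigma> (f i) (z i) = birkhoff_min p 1 (\<lambda>v. fibre_min p (z i) (\<lambda>\<theta>. \<sigma> * phi (z i) \<theta> + f i \<theta>) (frac (\<sigma> * v)))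
      (frac (- \<sigma> / z i))"
    using z by eventually_elim (rule birkhoff_min_transfer[OF assms(1,2)], auto)
  then have eq: "\<forall>\<^sub>F i in F. birkhoff_min p \<sigma> (f i) (z i) - birkhoff_min p 1 (\<lambda>_. 0) (frac (- \<sigma> / z i))
     = birkhoff_min p 1 (\<lambda>v. fibre_min p (z i) (\<lambda>\<theta>. \<sigma> * phi (z i) \<theta> + f i \<theta>) (frac (\<sigma> * v))) (frac (- \<sigma> / z i))
       - birkhoff_min p 1 (\<lambda>_. 0) (frac (- \<sigma> / z i))"
    by eventually_elim simp
  show ?thesis
    unfolding tendsto_cong[OF eq] limit_min_transfer[OF assms(1-5) w, symmetric]
    using assms(10)[unfolded right_limit_law_def, rule_format, OF ren tame] .
qed

lemma den_pos:
  assumes "x \<in> \<rat>"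
  shows "den x > 0"
proof -
  obtain m n :: nat where mn: "n \<noteq> 0" "\<bar>x\<bar> = real m / real n" "coprime m n"
    using Rats_abs_nat_div_natE[OF assms] by blast
  then have "x = of_int (int m) / real n \<or> x = of_int (- int m) / real n" by auto
  moreover have "den (of_int (int m) / real n) = n" "den (of_int (- int m) / real n) = n"
    using mn by (intro den_eq; simp)+
  ultimately show ?thesis using mn(1) by auto
qed

lemma softmin_singleton: "p < 0 \<Longrightarrow> softmin p {i} g = g i"
  by (erule negative_ereal_cases) auto

text \<open>After one transfer each inner soft minimum is its unweighted value plus
  \<open>f0 (1/2)\<close>, up to an error uniform in M. The outer soft minimum preserves this error,
  however many M there are.\<close>

lemma right_limit_law_zero:
  assumes "p < 0"
  shows "right_limit_law p F 0 1"
  unfolding right_limit_law_def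
proof (intro allI impI)
  fix x f f0
  assume x0: "(x \<longlongrightarrow> real 0 / real 1) F" and x: "\<forall>\<^sub>F i in F. x i \<in> \<rat> \<and> real 0 / real 1 < x i"
    and tame: "tame F f f0 1 0 1"
  have half: "frac (1 / 2 :: real) = 1 / 2" by (simp add: frac_eq)
  obtain B where B: "\<forall>\<^sub>F i in F. \<forall>\<theta>. 0 \<le> \<theta> \<longrightarrow> \<theta> < 1 \<longrightarrow> \<bar>f i \<theta>\<bar> \<le> B"
    using tame by (auto simp: tame_def)
  have conv: "((\<lambda>(i, \<theta>). f i \<theta>) \<longlongrightarrow> f0 (1/2)) (F \<times>\<^sub>F nhds (1/2))"
    using tame by (simp add: tame_def half)
  have right: "filterlim x (at_right 0) F"
    unfolding filterlim_at using x0 x by (auto elim: eventually_mono)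
  have "((\<lambda>i. birkhoff_min p 1 (f i) (x i) - birkhoff_min p 1 (\<lambda>_. 0) (x i)) \<longlongrightarrow> f0 (1/2)) F"
  proof (rule tendstoI)
    fix e :: real assume "e > 0"
    define e' where "e' = e / 4"
    have e': "e' > 0" using \<open>e > 0\<close> by (simp add: e'_def)
    have "\<forall>\<^sub>F y in F \<times>\<^sub>F nhds (1/2). dist (case y of (i, \<theta>) \<Rightarrow> f i \<theta>) (f0 (1/2)) < e'"
      by (rule tendstoD[OF conv e'])
    then obtain P R where P: "\<forall>\<^sub>F i in F. P i" and R: "\<forall>\<^sub>F \<theta> in nhds (1/2). R \<theta>"
      and PR: "\<And>i \<theta>. P i \<Longrightarrow> R \<theta> \<Longrightarrow> \<bar>f i \<theta> - f0 (1/2)\<bar> < e'"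
      unfolding eventually_prod_filter by (auto simp: dist_real_def)
    obtain \<eta> where \<eta>: "\<eta> > 0" "\<And>\<theta>. \<bar>\<theta> - 1/2\<bar> < \<eta> \<Longrightarrow> R \<theta>"
      using R unfolding eventually_nhds_metric by (auto simp: dist_real_def)
    have "\<forall>\<^sub>F i in F. x i < 1" using x0 by (intro order_tendstoD(2)[OF x0]) simp
    \<comment> \<open>Concentration is uniform in the weight, so it applies to \<open>f i\<close>,
      which changes with \<open>i\<close>.\<close>
    moreover note filterlim_iff[THEN iffD1, OF right, rule_format, OF fibre_min_concentration[OF assms \<eta>(1) e', of "\<bar>B\<bar>", OF abs_ge_zero]]
    ultimately show "\<forall>\<^sub>F i in F. dist (birkhoff_min p 1 (f i) (x i) - birkhoff_min p 1 (\<lambda>_. 0) (x i)) (f0 (1/2)) < e"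
      using B P x
    proof eventually_elim
      case (elim i)
      define w where "w = frac (- 1 / x i)"
      have xi: "x i \<in> \<rat>" "0 < x i" "x i < 1" using elim by auto
      have "w \<in> \<rat>" using xi by (auto simp: w_def)
      from den_pos[OF this] have ne: "finite {..<den w}" "{..<den w} \<noteq> {}" by auto
      have tr: "birkhoff_min p 1 g (x i) = softmin p {..<den w}
          (\<lambda>M. S M w + fibre_min p (x i) (\<lambda>\<theta>. phi (x i) \<theta> + g \<theta>) (frac (real M * w)))" for g
        using birkhoff_min_transfer[OF assms _ xi, of 1 g] by (simp add: birkhoff_min_def w_def)
      have "\<bar>birkhoff_min p 1 (f i) (x i) - softmin p {..<den w} (\<lambda>M. (S M w + fibre_min p (x i) (phi (x i)) (frac (real M * w))) + f0 (1/2))\<bar> \<le> 3 * e'"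
        unfolding tr
      proof (rule softmin_near[OF assms ne])
        fix M
        have "\<bar>fibre_min p (x i) (\<lambda>\<theta>. phi (x i) \<theta> + f i \<theta>) (frac (real M * w)) - (fibre_min p (x i) (phi (x i)) (frac (real M * w)) + f0 (1/2))\<bar> \<le> 3 * e'"
        proof (rule elim(2)[rule_format])
          show "\<bar>f i \<theta>\<bar> \<le> \<bar>B\<bar>" if "0 \<le> \<theta>" "\<theta> < 1" for \<theta>
            using elim(3) that by (meson abs_ge_self order_trans)
          show "\<bar>f i \<theta> - f0 (1/2)\<bar> \<le> e'" if "\<bar>\<theta> - 1/2\<bar> < \<eta>" for \<theta>
            using PR[OF elim(4) \<eta>(2)[OF that]] by simp
        qed (simp_all add: frac_lt_1)
        then show "\<bar>S M w + fibre_min p (x i) (\<lambda>\<theta>. phi (x i) \<theta> + f i \<theta>) (frac (real M * w))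
            - (S M w + fibre_min p (x i) (phi (x i)) (frac (real M * w)) + f0 (1/2))\<bar> \<le> 3 * e'" by simp
      qed
      moreover have "softmin p {..<den w} (\<lambda>M. (S M w + fibre_min p (x i) (phi (x i)) (frac (real M * w))) + f0 (1/2))
          = birkhoff_min p 1 (\<lambda>_. 0) (x i) + f0 (1/2)"
        unfolding tr softmin_add_const[OF assms ne] by simp
      ultimately have "\<bar>birkhoff_min p 1 (f i) (x i) - birkhoff_min p 1 (\<lambda>_. 0) (x i) - f0 (1/2)\<bar> \<le> 3 * e'" by simp
      then show ?case using \<open>e > 0\<close> by (simp add: dist_real_def e'_def)
    qed
  qed
  moreover have "limit_min p 1 g 0 1 = g (1/2)" for g
    by (simp add: limit_min_def softmin_singleton[OF assms] half lessThan_Suc)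
  ultimately show "((\<lambda>i. birkhoff_min p 1 (f i) (x i) - birkhoff_min p 1 (\<lambda>_. 0) (x i)) \<longlongrightarrow>
      limit_min p 1 f0 0 1 - limit_min p 1 (\<lambda>_. 0) 0 1) F" by simp
qed

text \<open>
  The map \<open>x \<mapsto> frac (- 1 / x)\<close> preserves one-sided approach from the right and lowers the
  denominator until \<open>0\<close> is reached, where the fibres concentrate.
\<close>

lemma right_limit_lawI:
  assumes "p < 0"
  shows "coprime b d \<Longrightarrow> b < d \<Longrightarrow> right_limit_law p F b d"
proof (induction d arbitrary: b rule: less_induct)
  case (less d)
  show ?case
  proof (cases "b = 0")
    case True
    then have "d = 1" using less.prems by simp
    then show ?thesis using True right_limit_law_zero[OF assms] by simp
  next
    case False
    define e where "e = nat (- int d mod int b)"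
    have e: "int e = - int d mod int b" using False by (simp add: e_def)
    have "int e < int b" using False unfolding e by simp
    then have "e < b" by simp
    have "coprime (int e) (int b)"
      unfolding e using less.prems by (simp add: coprime_commute coprime_mod_left_iff False)
    then have IH: "right_limit_law p F e b"
      using less.IH[OF \<open>b < d\<close>] \<open>e < b\<close> by simp
    have w: "frac (- 1 / (real b / real d)) = real e / real b"
      using frac_of_int_divide[of b "- int d"] False by (simp flip: e)
    show ?thesis
      unfolding right_limit_law_def
    proof (intro allI impI)
      fix x f f0
      assume x0: "(x \<longlongrightarrow> real b / real d) F" and x: "\<forall>\<^sub>F i in F. x i \<in> \<rat> \<and> real b / real d < x i"
        and tame: "tame F f f0 1 b d"
      have "\<forall>\<^sub>F i in F. x i < 1" using less.prems by (intro order_tendstoD(2)[OF x0]) simp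
      with x have x': "\<forall>\<^sub>F i in F. x i \<in> \<rat> \<and> 0 < x i \<and> x i < 1 \<and> 0 < 1 * (x i - real b / real d)"
      proof eventually_elim
        case (elim i)
        have "0 \<le> real b / real d" by simp
        then have "0 < x i" using elim by linarith
        then show ?case using elim by simp
      qed
      have "0 < b" "b \<le> d" using False less.prems by auto
      \<comment> \<open>Both steps compare with the same soft minimum at the renormalized point, so
        it cancels together with the additive constant.\<close>
      from tendsto_diff[OF birkhoff_min_step[OF assms _ this less.prems(1) x0 x' tame w IH]
          birkhoff_min_step[OF assms _ this less.prems(1) x0 x' tame_zero w IH]]
      show "((\<lambda>i. birkhoff_min p 1 (f i) (x i) - birkhoff_min p 1 (\<lambda>_. 0) (x i)) \<longlongrightarrow>
          limit_min p 1 f0 b d - limit_min p 1 (\<lambda>_. 0) b d) F" by simp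
    qed
  qed
qed

section \<open>The limits of h\<close>

lemma S_reflect:
  assumes "coprime m n" "N < n" "x = real m / real n \<or> x = - (real m / real n)"
  shows "S N (- x) = - S N x"
proof (rule S_minus)
  fix k assume "0 < k" "k \<le> N"
  then have "real k * (real m / real n) \<notin> \<int>" using assms by (intro mult_divide_not_Ints) auto
  then show "real k * x \<notin> \<int>" using assms(3) by auto
qed

text \<open>Joins the steps through {-1/z} to the Gauss map, which uses {1/z}; the price is the sign
  of \<open>S\<close>.\<close>

lemma birkhoff_min_reflect:
  assumes "x \<in> \<rat>"
  shows "birkhoff_min p 1 (\<lambda>_. 0) (frac (- x)) = birkhoff_min p (-1) (\<lambda>_. 0) (frac x)"
proof -
  obtain m n :: nat where mn: "n \<noteq> 0" "\<bar>x\<bar> = real m / real n" "coprime m n"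
    using Rats_abs_nat_div_natE[OF assms] by blast
  then have x: "x = real m / real n \<or> x = - (real m / real n)" by linarith
  have "den (frac (of_int (int m) / real n)) = n" "den (frac (of_int (- int m) / real n)) = n"
    using mn by (intro den_frac; simp)+
  then have "den (frac x) = n" "den (frac (- x)) = n" using x by auto
  then show ?thesis
    unfolding birkhoff_min_def using S_reflect[OF mn(3) _ x] by (auto intro!: softmin_cong)
qed

lemma limit_min_reflect:
  assumes "coprime c d" "frac (- (real c / real d)) = real e / real d"
  shows "limit_min p (-1) (\<lambda>_. 0) c d = limit_min p 1 (\<lambda>_. 0) e d"
proof -
  have "S N (real e / real d) = - S N (real c / real d)" if "N < d" for N
    using S_reflect[OF assms(1) that, of "real c / real d"] S_frac[of N "- (real c / real d)"] assms(2)
    by simp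
  then show ?thesis unfolding limit_min_def by (intro softmin_cong) auto
qed

section \<open>The functions h and W as differences of soft minima\<close>

lemma gauss_eq: "gauss x = frac (1 / x)"
  by (simp add: gauss_def)

lemma ln_J:
  assumes "x \<in> \<rat>"
  shows "J p x > 0"
    and "p < 0 \<Longrightarrow> ln (J p x) = birkhoff_min p 1 (\<lambda>_. 0) x"
    and "p > 0 \<Longrightarrow> ln (J p x) = - birkhoff_min (- p) (-1) (\<lambda>_. 0) x"
proof -
  have ne: "finite {..<den x}" "{..<den x} \<noteq> {}" using den_pos[OF assms] by auto
  have sum: "(\<Sum>N<den x. exp (t * S N x)) > 0" for t by (rule sum_exp_pos[OF ne])
  have Max: "ln (MAX N\<in>{..<den x}. exp (S N x)) = (MAX N\<in>{..<den x}. S N x)"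
    and Min: "ln (MIN N\<in>{..<den x}. exp (S N x)) = (MIN N\<in>{..<den x}. S N x)"
  proof -
    have "mono (exp :: real \<Rightarrow> real)" by (simp add: mono_def)
    from mono_Max_commute[OF this, of "(\<lambda>N. S N x) ` {..<den x}"]
      mono_Min_commute[OF this, of "(\<lambda>N. S N x) ` {..<den x}"]
    have "exp (MAX N\<in>{..<den x}. S N x) = (MAX N\<in>{..<den x}. exp (S N x))"
      "exp (MIN N\<in>{..<den x}. S N x) = (MIN N\<in>{..<den x}. exp (S N x))"
      using ne by (simp_all add: image_image)
    then show "ln (MAX N\<in>{..<den x}. exp (S N x)) = (MAX N\<in>{..<den x}. S N x)"
      "ln (MIN N\<in>{..<den x}. exp (S N x)) = (MIN N\<in>{..<den x}. S N x)"
      by (metis ln_exp)+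
  qed
  show "J p x > 0"
  proof (cases p)
    case (real t)
    then show ?thesis using sum[of t] by (simp add: J_def)
  qed (use ne in \<open>auto simp: J_def Max_gr_iff Min_gr_iff\<close>)
  show "ln (J p x) = birkhoff_min p 1 (\<lambda>_. 0) x" if "p < 0"
    using that
  proof (cases rule: negative_ereal_cases)
    case (1 t)
    then show ?thesis using sum[of t] by (simp add: J_def birkhoff_min_def ln_powr)
  next
    case 2
    then show ?thesis using Min by (simp add: J_def birkhoff_min_def)
  qed
  show "ln (J p x) = - birkhoff_min (- p) (-1) (\<lambda>_. 0) x" if "p > 0"
  proof (cases p)
    case (real t)
    then show ?thesis using that sum[of t] by (simp add: J_def birkhoff_min_def ln_powr)
  next
    case PInf
    have "- Max ((\<lambda>N. S N x) ` {..<den x}) = Min (uminus ` (\<lambda>N. S N x) ` {..<den x})"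
      using ne by (intro minus_Max_eq_Min) auto
    then show ?thesis using PInf Max by (simp add: J_def birkhoff_min_def image_image)
  qed (use that in simp)
qed

lemma h_eq:
  assumes "x \<in> \<rat>"
  shows "p < 0 \<Longrightarrow> h p x = birkhoff_min p 1 (\<lambda>_. 0) x - birkhoff_min p 1 (\<lambda>_. 0) (frac (1 / frac (1 / x)))"
    and "p > 0 \<Longrightarrow> h p x = birkhoff_min (- p) (-1) (\<lambda>_. 0) (frac (1 / frac (1 / x))) - birkhoff_min (- p) (-1) (\<lambda>_. 0) x"
proof -
  have g: "(gauss ^^ 2) x = frac (1 / frac (1 / x))" by (simp add: numeral_2_eq_2 gauss_eq)
  have "frac (1 / frac (1 / x)) \<in> \<rat>" using assms by simp
  note J = ln_J[OF assms] ln_J[OF this]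
  show "p < 0 \<Longrightarrow> h p x = birkhoff_min p 1 (\<lambda>_. 0) x - birkhoff_min p 1 (\<lambda>_. 0) (frac (1 / frac (1 / x)))"
    using J[of p] by (simp add: h_def g ln_div)
  show "p > 0 \<Longrightarrow> h p x = birkhoff_min (- p) (-1) (\<lambda>_. 0) (frac (1 / frac (1 / x))) - birkhoff_min (- p) (-1) (\<lambda>_. 0) x"
    using J[of p] by (simp add: h_def g ln_div)
qed

lemma W_eq:
  assumes "0 < q" "0 < q'"
  shows "p < 0 \<Longrightarrow> W p a q a' q' = limit_min p 1 (\<lambda>_. 0) a q - limit_min p 1 (\<lambda>_. 0) a' q'
      + of_int \<lfloor>real q / real a\<rfloor> * (- 2 * real a - 1) / (8 * real q * real q')"
    and "p > 0 \<Longrightarrow> W p a q a' q' = limit_min (- p) (-1) (\<lambda>_. 0) a' q' - limit_min (- p) (-1) (\<lambda>_. 0) a q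
      + of_int \<lfloor>real q / real a\<rfloor> * (2 * real a - 1) / (8 * real q * real q')"
proof -
  have ne: "finite {..<n}" "{..<n} \<noteq> {}" if "0 < n" for n :: nat using that by auto
  have sum: "(\<Sum>N<n. exp (u N :: real)) > 0" "(\<Sum>N<n. exp (u N :: real)) \<noteq> 0" if "0 < n" for u and n :: nat
    using sum_exp_pos[OF ne[OF that], of u] by simp_all
  show "W p a q a' q' = limit_min p 1 (\<lambda>_. 0) a q - limit_min p 1 (\<lambda>_. 0) a' q'
      + of_int \<lfloor>real q / real a\<rfloor> * (- 2 * real a - 1) / (8 * real q * real q')" if "p < 0"
    using that
  proof (cases rule: negative_ereal_cases)
    case (1 t)
    then show ?thesis
      using sum[OF assms(1)] sum[OF assms(2)]
      by (simp add: W_def limit_min_def ln_div diff_divide_distrib)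
  qed (simp add: W_def limit_min_def)
  show "W p a q a' q' = limit_min (- p) (-1) (\<lambda>_. 0) a' q' - limit_min (- p) (-1) (\<lambda>_. 0) a q
      + of_int \<lfloor>real q / real a\<rfloor> * (2 * real a - 1) / (8 * real q * real q')" if "p > 0"
  proof (cases p)
    case (real t)
    then have "t > 0" using that by simp
    have "- (t * (real N / (2 * real n) - S N x)) = t * (S N x - real N / (2 * real n))" for N n x
      by (simp add: algebra_simps)
    then show ?thesis
      using real \<open>t > 0\<close> sum[OF assms(1)] sum[OF assms(2)]
      by (simp add: W_def limit_min_def ln_div diff_divide_distrib)
  next
    case PInf
    have "(MAX N\<in>{..<n}. S N x - real N / (2 * real n)) = - (MIN N\<in>{..<n}. - S N x + real N / (2 * real n))"
      if "0 < n" for n x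
      using minus_Max_eq_Min[of "(\<lambda>N. S N x - real N / (2 * real n)) ` {..<n}"] ne[OF that]
      by (simp add: image_image)
    then show ?thesis using PInf assms by (simp add: W_def limit_min_def)
  qed (use that in simp)
qed

lemma frac_reduced:
  fixes k :: int
  assumes "0 < d" "coprime k (int d)"
  obtains e where "e < d" "coprime e d" "frac (of_int k / real d) = real e / real d"
proof -
  define e where "e = nat (k mod int d)"
  have e: "int e = k mod int d" using assms by (simp add: e_def)
  have "int e < int d" using assms unfolding e by simp
  then have "e < d" by simp
  moreover have "coprime (int e) (int d)" unfolding e using assms by (simp add: coprime_mod_left_iff)
  moreover have "frac (of_int k / real d) = real e / real d"
    using frac_of_int_divide[OF assms(1), of k] by (simp flip: e)
  ultimately show ?thesis using that by simp
qed

lemma reduced_unique: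
  assumes "real a / real b = real c / real d" "0 < b" "0 < d" "coprime a b" "coprime c d"
  shows "a = c \<and> b = d"
proof -
  have "b = d" using den_of_nat_divide[of b a] den_of_nat_divide[of d c] assms by simp
  then show ?thesis using assms by simp
qed

text \<open>The first step, with sign 1, leads from r to {-1/r}, approaching b/a from the right.
  Reflection passes to {1/r}, which approaches c/a from the left, and a step with sign -1 leads on
  to T^2 r.\<close>

lemma h_limit_right:
  assumes "p < 0" "0 < a" "a < q" "coprime a q" "0 < q'" "coprime a' q'"
    and img: "real a' / real q' = (gauss ^^ 2) (real a / real q)"
  shows "(h p \<longlongrightarrow> W p a q a' q' + (if a = 1 then 3 / (8 * real q) else 0))
    (at (real a / real q) within {real a / real q<..} \<inter> \<rat>)"
proof -
  let ?F = "at (real a / real q) within {real a / real q<..} \<inter> \<rat>"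
  have z0: "((\<lambda>r. r) \<longlongrightarrow> real a / real q) ?F" by (rule tendsto_ident_at)
  have "real a / real q < 1" using assms(3) by simp
  have "\<forall>\<^sub>F r in ?F. r \<in> {real a / real q<..} \<inter> \<rat>" by (simp add: eventually_at_filter)
  with order_tendstoD(2)[OF z0 \<open>real a / real q < 1\<close>]
  have z: "\<forall>\<^sub>F r in ?F. r \<in> \<rat> \<and> 0 < r \<and> r < 1 \<and> 0 < 1 * (r - real a / real q)"
  proof eventually_elim
    case (elim r)
    have "0 \<le> real a / real q" by simp
    moreover have "real a / real q < r" using elim by simp
    ultimately have "0 < r" by linarith
    then show ?case using elim by auto
  qed
  obtain b where b: "b < a" "coprime b a" "frac (of_int (- int q) / real a) = real b / real a"
    using frac_reduced[of a "- int q"] assms(2,4) by (auto simp: coprime_commute)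
  have w0: "frac (- 1 / (real a / real q)) = real b / real a" using b(3) by simp
  note step1 = birkhoff_min_step[OF assms(1) _ assms(2) less_imp_le[OF assms(3)] assms(4) z0 z tame_zero w0
      right_limit_lawI[OF assms(1) b(2,1)], simplified]
  \<comment> \<open>{1/r} = 1 - {-1/r} tends to 1 - b/a = c/a. For a = 1 this is 1, the reason why
    the steps admit the limit point c/d = 1.\<close>
  define c where "c = a - b"
  have c: "0 < c" "c \<le> a" "coprime c a"
    using b(1,2) by (auto simp: c_def coprime_iff_gcd_eq_1 gcd_diff2_nat)
  have ca: "real c / real a = 1 - real b / real a" using b(1) by (simp add: c_def of_nat_diff diff_divide_distrib)
  have z': "\<forall>\<^sub>F r in ?F. r \<in> \<rat> \<and> 0 < r \<and> 0 < 1 * (r - real a / real q)"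
    using z by eventually_elim auto
  have "0 < real a / real q" using assms(2,3) by simp
  note w = renormalized_tendsto_right[OF _ this z0 z', simplified w0, simplified]
  have y: "\<forall>\<^sub>F r in ?F. frac (1 / r) = 1 - frac (- (1 / r)) \<and> frac (1 / r) \<in> \<rat> \<and> 0 < frac (1 / r) \<and> frac (1 / r) < 1
      \<and> 0 < (-1) * (frac (1 / r) - real c / real a)"
    using w(2) z
  proof eventually_elim
    case (elim r)
    have "0 \<le> real b / real a" by simp
    then have pos: "0 < frac (- (1 / r))" using elim by linarith
    then have "frac (1 / r) = 1 - frac (- (1 / r))"
      by (simp add: frac_neg split: if_splits)
    then show ?case using elim pos frac_lt_1[of "- (1 / r)"] by (simp add: ca)
  qed
  have "((\<lambda>r. 1 - frac (- (1 / r))) \<longlongrightarrow> real c / real a) ?F"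
    unfolding ca by (intro tendsto_intros w(1))
  moreover have "\<forall>\<^sub>F r in ?F. frac (1 / r) = 1 - frac (- (1 / r))" using y by eventually_elim auto
  ultimately have y0: "((\<lambda>r. frac (1 / r)) \<longlongrightarrow> real c / real a) ?F" by (simp add: tendsto_cong)
  have y': "\<forall>\<^sub>F r in ?F. frac (1 / r) \<in> \<rat> \<and> 0 < frac (1 / r) \<and> frac (1 / r) < 1
      \<and> 0 < (-1) * (frac (1 / r) - real c / real a)"
    using y by (rule eventually_mono) blast
  obtain e where e: "e < c" "coprime e c" "frac (of_int (int a) / real c) = real e / real c"
    using frac_reduced[of c "int a"] c by (auto simp: coprime_commute)
  have v0: "frac (- (-1) / (real c / real a)) = real e / real c" using e(3) by simp
  note step2 = birkhoff_min_step[OF assms(1) _ c y0 y' tame_zero v0 right_limit_lawI[OF assms(1) e(2,1)], simplified]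
  have refl: "limit_min p (-1) (\<lambda>_. 0) c a = limit_min p 1 (\<lambda>_. 0) b a"
  proof (rule limit_min_reflect[OF c(3)])
    have "real b / real a < 1" using b(1) by simp
    then show "frac (- (real c / real a)) = real b / real a"
      unfolding ca by (simp add: frac_unique_iff)
  qed
  have "real a' / real q' = real e / real c"
  proof (cases "a = 1")
    case True
    \<comment> \<open>{1/r} tends to 1 whereas the Gauss map sends 1/q to 0, but the next Gauss step
      sends both to 0.\<close>
    then have "c = 1" "e = 0" using c e(1) by auto
    moreover have frac_q: "frac (real q) = 0" by (simp add: frac_eq_0_iff)
    ultimately show ?thesis using img True by (simp add: numeral_2_eq_2 gauss_eq frac_q)
  next
    case False
    then have "b \<noteq> 0" using b(2) by (intro notI) simp
    then have "frac (- (real q / real a)) \<noteq> 0" using b(3) assms(2) by simp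
    then have "frac (real q / real a) = real c / real a"
      using b(3) by (simp add: frac_neg ca split: if_splits)
    then show ?thesis using img v0 by (simp add: numeral_2_eq_2 gauss_eq)
  qed
  then have eq: "a' = e" "q' = c" using reduced_unique assms(5,6) e(2) c(1) by blast+
  have h: "\<forall>\<^sub>F r in ?F. (birkhoff_min p 1 (\<lambda>_. 0) r - birkhoff_min p 1 (\<lambda>_. 0) (frac (- (1 / r))))
      + (birkhoff_min p (-1) (\<lambda>_. 0) (frac (1 / r)) - birkhoff_min p 1 (\<lambda>_. 0) (frac (1 / frac (1 / r)))) = h p r"
    using z by eventually_elim (simp add: h_eq(1) assms(1) birkhoff_min_reflect)
  \<comment> \<open>The two step constants add up to -(2 a + 1)/(8 q c) times (q - c)/a, the
    eventual value of floor(1/r). It equals floor(q/a) for a > 1 and q - 1 for a = 1, whence the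
    extra 3/(8 q).\<close>
  have const: "(2 * real a - 2 * real q + 1) / (8 * real a * real q) + (2 * real c - 2 * real a - 1) / (8 * real c * real a)
      = of_int \<lfloor>real q / real a\<rfloor> * (- 2 * real a - 1) / (8 * real q * real c) + (if a = 1 then 3 / (8 * real q) else 0)"
    (is "?C = _")
  proof -
    have C: "?C = (real q - real c) / real a * (- 2 * real a - 1) / (8 * real q * real c)"
      using assms(2,3) c(1) by (simp add: divide_simps) (simp add: algebra_simps)
    show ?thesis
    proof (cases "a = 1")
      case True
      then have "c = 1" using c by auto
      then show ?thesis unfolding C using True assms(3) by (simp add: field_simps)
    next
      case False
      then have "b \<noteq> 0" using b(2) by (intro notI) simp
      then have "frac (- (real q / real a)) \<noteq> 0" using b(3) assms(2) by simp
      then have "frac (real q / real a) = real c / real a"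
        using b(3) by (simp add: frac_neg ca split: if_splits)
      then have "of_int \<lfloor>real q / real a\<rfloor> = (real q - real c) / real a"
        by (simp add: frac_def diff_divide_distrib)
      then show ?thesis unfolding C using False by simp
    qed
  qed
  show ?thesis
    using tendsto_add[OF step1 step2] assms(2,3,5) const
    unfolding tendsto_cong[OF h] by (simp add: W_eq(1)[OF _ _ assms(1)] refl eq algebra_simps)
qed

text \<open>Replacing p by -p and S by -S, the first step has sign -1 and leads from r on the left
  to {1/r} on the right of b/a; the second has sign 1 and ends at {-1/{1/r}}, which reflection turns
  into T^2 r.\<close>

lemma h_limit_left:
  assumes "p > 0" "1 < a" "a < q" "coprime a q" "0 < q'" "coprime a' q'"
    and img: "real a' / real q' = (gauss ^^ 2) (real a / real q)"
  shows "(h p \<longlongrightarrow> W p a q a' q') (at (real a / real q) within {..<real a / real q} \<inter> \<rat>)"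
proof -
  let ?F = "at (real a / real q) within {..<real a / real q} \<inter> \<rat>"
  have p: "- p < 0" using assms(1) by (simp add: ereal_uminus_less_reorder)
  have a: "0 < a" using assms(2) by simp
  have z0: "((\<lambda>r. r) \<longlongrightarrow> real a / real q) ?F" by (rule tendsto_ident_at)
  have aq: "real a / real q < 1" "0 < real a / real q" using assms(2,3) by auto
  have "\<forall>\<^sub>F r in ?F. r \<in> {..<real a / real q} \<inter> \<rat>" by (simp add: eventually_at_filter)
  with order_tendstoD(1)[OF z0 aq(2)]
  have z: "\<forall>\<^sub>F r in ?F. r \<in> \<rat> \<and> 0 < r \<and> r < 1 \<and> 0 < (-1) * (r - real a / real q)"
    by eventually_elim (use aq in auto)
  obtain b where b: "b < a" "coprime b a" "frac (of_int (int q) / real a) = real b / real a"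
    using frac_reduced[of a "int q"] a assms(4) by (auto simp: coprime_commute)
  have w0: "frac (- (-1) / (real a / real q)) = real b / real a" using b(3) by simp
  note step1 = birkhoff_min_step[OF p _ a less_imp_le[OF assms(3)] assms(4) z0 z tame_zero w0
      right_limit_lawI[OF p b(2,1)], simplified]
  \<comment> \<open>Here a > 1 is essential: it keeps the limit b/a of {1/r} away from 0, as the
    second step demands.\<close>
  have "b \<noteq> 0" using b(2) assms(2) by (intro notI) simp
  then have b0: "0 < b" by simp
  have z': "\<forall>\<^sub>F r in ?F. r \<in> \<rat> \<and> 0 < r \<and> 0 < (-1) * (r - real a / real q)"
    using z by eventually_elim auto
  note y = renormalized_tendsto_right[OF _ aq(2) z0 z', simplified w0, simplified]
  have y': "\<forall>\<^sub>F r in ?F. frac (1 / r) \<in> \<rat> \<and> 0 < frac (1 / r) \<and> frac (1 / r) < 1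
      \<and> 0 < 1 * (frac (1 / r) - real b / real a)"
    using y(2)
  proof eventually_elim
    case (elim r)
    have "0 \<le> real b / real a" by simp
    then have "0 < frac (1 / r)" using elim by linarith
    then show ?case using elim by (simp add: frac_lt_1)
  qed
  obtain e where e: "e < b" "coprime e b" "frac (of_int (- int a) / real b) = real e / real b"
    using frac_reduced[of b "- int a"] b b0 by (auto simp: coprime_commute)
  have v0: "frac (- 1 / (real b / real a)) = real e / real b" using e(3) by simp
  have "coprime b a" "b \<le> a" using b by auto
  note step2 = birkhoff_min_step[OF p _ b0 this(2,1) y(1) y' tame_zero v0 right_limit_lawI[OF p e(2,1)], simplified]
  \<comment> \<open>The second step ends near {-a/b} = e/b, while the Gauss image is {a/b} = e'/b;
    reflection identifies their limiting values.\<close>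
  obtain e' where e': "e' < b" "coprime e' b" "frac (of_int (int a) / real b) = real e' / real b"
    using frac_reduced[of b "int a"] b b0 by (auto simp: coprime_commute)
  have "real a' / real q' = real e' / real b"
    using img b(3) e'(3) by (simp add: numeral_2_eq_2 gauss_eq)
  then have eq: "a' = e'" "q' = b" using reduced_unique assms(5,6) e'(2) b0 by blast+
  have refl: "limit_min (- p) (-1) (\<lambda>_. 0) e' b = limit_min (- p) 1 (\<lambda>_. 0) e b"
  proof (rule limit_min_reflect[OF e'(2)])
    have "frac (- (frac (real a / real b))) = frac (- (real a / real b))"
      using frac_sign_mult_frac[of "-1" "real a / real b" 0] by simp
    then show "frac (- (real e' / real b)) = real e / real b" using e(3) e'(3) by simp
  qed
  have h: "\<forall>\<^sub>F r in ?F. - ((birkhoff_min (- p) (-1) (\<lambda>_. 0) r - birkhoff_min (- p) 1 (\<lambda>_. 0) (frac (1 / r)))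
      + (birkhoff_min (- p) 1 (\<lambda>_. 0) (frac (1 / r)) - birkhoff_min (- p) 1 (\<lambda>_. 0) (frac (- (1 / frac (1 / r)))))) = h p r"
    using z by eventually_elim (simp add: h_eq(2) assms(1) birkhoff_min_reflect)
  have const: "(2 * real a - 2 * real q - 1) / (8 * real a * real q) + (2 * real b - 2 * real a + 1) / (8 * real b * real a)
      = - (of_int \<lfloor>real q / real a\<rfloor> * (2 * real a - 1) / (8 * real q * real b))" (is "?C = _")
  proof -
    have "?C = - ((real q - real b) / real a * (2 * real a - 1) / (8 * real q * real b))"
      using a assms(3) b0 by (simp add: divide_simps) (simp add: algebra_simps)
    moreover have "of_int \<lfloor>real q / real a\<rfloor> = (real q - real b) / real a"
      using b(3) by (simp add: frac_def diff_divide_distrib)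
    ultimately show ?thesis by simp
  qed
  show ?thesis
    using tendsto_minus[OF tendsto_add[OF step1 step2]] assms(3,5) const
    unfolding tendsto_cong[OF h] by (simp add: W_eq(2)[OF _ _ assms(1)] refl eq algebra_simps)
qed

theorem theorem4:
  fixes a q a' q' :: nat and p :: ereal
  assumes "0 < a" "a < q" "coprime a q"
    and "0 < q'" "coprime a' q'"
    and "real a' / real q' = (gauss ^^ 2) (real a / real q)"
  shows "(p < 0 \<and> a \<noteq> 1 \<longrightarrow>
           (h p \<longlongrightarrow> W p a q a' q') (at (real a / real q) within {real a / real q<..} \<inter> \<rat>))
       \<and> (p < 0 \<and> a = 1 \<longrightarrow>
           (h p \<longlongrightarrow> W p a q a' q' + 3 / (8 * real q))
             (at (real a / real q) within {real a / real q<..} \<inter> \<rat>))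
       \<and> (0 < p \<and> a \<noteq> 1 \<longrightarrow>
           (h p \<longlongrightarrow> W p a q a' q') (at (real a / real q) within {..<real a / real q} \<inter> \<rat>))"
proof (intro conjI impI; elim conjE)
  assume "p < 0" "a \<noteq> 1"
  then show "(h p \<longlongrightarrow> W p a q a' q') (at (real a / real q) within {real a / real q<..} \<inter> \<rat>)"
    using h_limit_right[OF _ assms] by simp
next
  assume "p < 0" "a = 1"
  then show "(h p \<longlongrightarrow> W p a q a' q' + 3 / (8 * real q)) (at (real a / real q) within {real a / real q<..} \<inter> \<rat>)"
    using h_limit_right[OF _ assms] by simp
next
  assume "0 < p" "a \<noteq> 1"
  then show "(h p \<longlongrightarrow> W p a q a' q') (at (real a / real q) within {..<real a / real q} \<inter> \<rat>)"
    using h_limit_left[OF _ _ assms(2-)] assms(1) by simp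
qed

end
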